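(* Let $\mathcal{M}=(\mathsf{M},\mathrm{Cof},\mathrm{Eq},\mathrm{Fib})$ be a Fresse (resp. coSpitzweck) right semimodel category and let $(\mathfrak{R},\eta)$ be a pointed homotopy idempotent functor (BF-reflector) on $\mathcal{M}$. Put $\mathrm{Eq}_{\mathfrak{R}}=\mathfrak{R}^{-1}(\mathrm{Eq})$ and let $\mathrm{Fib}_{\mathfrak{R}}$ be the class of maps with the right lifting property with respect to all maps in $\mathrm{Cof}\cap \mathrm{Eq}_{\mathfrak{R}}$. Then $\mathcal{M}_{\mathfrak{R}}=(\mathsf{M},\mathrm{Cof},\mathrm{Eq}_{\mathfrak{R}},\mathrm{Fib}_{\mathfrak{R}})$ is a Fresse (resp. coSpitzweck) right semimodel category, and it is the left Bousfield localization of $\mathcal{M}$ at the class $\mathrm{Eq}_{\mathfrak{R}}$ of $\mathfrak{R}$-equivalences among Fresse (resp. coSpitzweck) right semimodel categories with left Quillen functors between them.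
   Context: A structured homotopical category is a category $\mathsf{M}$ with all limits and colimits and three classes of maps $\mathrm{Cof}$ (cofibrations), $\mathrm{Eq}$ (equivalences), $\mathrm{Fib}$ (fibrations) such that $\mathrm{Eq}$ is closed under retracts and satisfies 2-out-of-3, $\mathrm{Cof}$ is closed under retracts and pushouts, and $\mathrm{Fib}$ is closed under retracts and pullbacks. "Acyclic" means also lying in $\mathrm{Eq}$. An object $X$ is cofibrant (fibrant) if the map from the initial object to $X$ is a cofibration (the map from $X$ to the terminal object is a fibration). A core fibration is a fibration with fibrant target. A Fresse right semimodel category is a structured homotopical category such that: (i) acyclic cofibrations have the left lifting property against core fibrations, and cofibrations have the left lifting property against core acyclic fibrations; (ii) any map with fibrant target factors as an acyclic cofibration followed by a core fibration, and also as a cofibration followed by a core acyclic fibration; (iii) the terminal object is fibrant. It is coSpitzweck if moreover $(\mathrm{Cof},\mathrm{Fib}\cap\mathrm{Eq})$ is a weak factorization system. A left Quillen functor between right semimodel categories is a left adjoint functor preserving cofibrations and acyclic cofibrations. A BF-reflector on $\mathcal{M}$ is an endofunctor $\mathfrak{R}\colon\mathsf{M}\to\mathsf{M}$ with a natural transformation $\eta\colon\mathrm{id}\Rightarrow\mathfrak{R}$ such that $\mathfrak{R}$ is homotopical (preserves equivalences) and both $\mathfrak{R}\eta$ and $\eta\mathfrak{R}$ are natural equivalences (i.e. objectwise equivalences). An $\mathfrak{R}$-equivalence is a map $f$ such that $\mathfrak{R}(f)\in\mathrm{Eq}$. The left Bousfield localization of $\mathcal{M}$ at a class of maps $W$, among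 a given type of (semi)model categories, is a (semi)model category $L_W\mathcal{M}$ of that type with a left Quillen functor $\mathcal{M}\to L_W\mathcal{M}$ which is initial among left Quillen functors $\mathcal{M}\to\mathcal{N}$ ($\mathcal{N}$ of that type) sending $W$ to equivalences. *)

theory Defs
  imports Main
begin

unbundle cardinal_syntax

text \<open>
  A category has explicit sets of objects and arrows inside two types; the operations are
  only constrained on these sets. \<open>Comp C g f\<close> is the composite ``\<open>g\<close> after \<open>f\<close>''.
\<close>

record ('o, 'a) category =
  Obj :: "'o set"
  Arr :: "'a set"
  Dom :: "'a \<Rightarrow> 'o"
  Cod :: "'a \<Rightarrow> 'o"
  Ident :: "'o \<Rightarrow> 'a"
  Comp :: "'a \<Rightarrow> 'a \<Rightarrow> 'a"  (infixl "\<cdot>\<index>" 70)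

definition Hom :: "('o, 'a, 'z) category_scheme \<Rightarrow> 'o \<Rightarrow> 'o \<Rightarrow> 'a set" where
  "Hom C X Y = {f \<in> Arr C. Dom C f = X \<and> Cod C f = Y}"

locale category =
  fixes C :: "('o, 'a, 'z) category_scheme" (structure)
  assumes Dom_closed: "f \<in> Arr C \<Longrightarrow> Dom C f \<in> Obj C"
    and Cod_closed: "f \<in> Arr C \<Longrightarrow> Cod C f \<in> Obj C"
    and Ident_closed: "X \<in> Obj C \<Longrightarrow> Ident C X \<in> Hom C X X"
    and Comp_closed: "f \<in> Hom C X Y \<Longrightarrow> g \<in> Hom C Y Z \<Longrightarrow> g \<cdot> f \<in> Hom C X Z"
    and Ident_left: "f \<in> Hom C X Y \<Longrightarrow> Ident C Y \<cdot> f = f"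
    and Ident_right: "f \<in> Hom C X Y \<Longrightarrow> f \<cdot> Ident C X = f"
    and Comp_assoc: "f \<in> Hom C W X \<Longrightarrow> g \<in> Hom C X Y \<Longrightarrow> h \<in> Hom C Y Z
      \<Longrightarrow> (h \<cdot> g) \<cdot> f = h \<cdot> (g \<cdot> f)"


record ('o, 'a, 'p, 'b) cat_functor =
  OMap :: "'o \<Rightarrow> 'p"
  AMap :: "'a \<Rightarrow> 'b"

definition is_functor :: "('o, 'a, 'y) category_scheme \<Rightarrow> ('p, 'b, 'z) category_scheme
    \<Rightarrow> ('o, 'a, 'p, 'b) cat_functor \<Rightarrow> bool" where
  "is_functor C D F \<longleftrightarrow> category C \<and> category D
    \<and> (\<forall>X \<in> Obj C. OMap F X \<in> Obj D)
    \<and> (\<forall>f \<in> Arr C. AMap F f \<in> Hom D (OMap F (Dom C f)) (OMap F (Cod C f)))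
    \<and> (\<forall>X \<in> Obj C. AMap F (Ident C X) = Ident D (OMap F X))
    \<and> (\<forall>f \<in> Arr C. \<forall>g \<in> Arr C. Cod C f = Dom C g
          \<longrightarrow> AMap F (Comp C g f) = Comp D (AMap F g) (AMap F f))"

text \<open>Functors are only determined by their values on the objects and arrows of the source.\<close>

definition functor_eq :: "('o, 'a, 'z) category_scheme
    \<Rightarrow> ('o, 'a, 'p, 'b) cat_functor \<Rightarrow> ('o, 'a, 'p, 'b) cat_functor \<Rightarrow> bool" where
  "functor_eq C F G \<longleftrightarrow> (\<forall>X \<in> Obj C. OMap F X = OMap G X) \<and> (\<forall>f \<in> Arr C. AMap F f = AMap G f)"

definition id_functor :: "('o, 'a, 'o, 'a) cat_functor" where
  "id_functor = \<lparr>OMap = (\<lambda>X. X), AMap = (\<lambda>f. f)\<rparr>"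

definition comp_functor :: "('p, 'b, 'q, 'c) cat_functor \<Rightarrow> ('o, 'a, 'p, 'b) cat_functor
    \<Rightarrow> ('o, 'a, 'q, 'c) cat_functor"  (infixl "\<circ>\<^sub>F" 60) where
  "G \<circ>\<^sub>F F = \<lparr>OMap = OMap G \<circ> OMap F, AMap = AMap G \<circ> AMap F\<rparr>"

definition natural_transformation :: "('o, 'a, 'y) category_scheme \<Rightarrow> ('p, 'b, 'z) category_scheme
    \<Rightarrow> ('o, 'a, 'p, 'b) cat_functor \<Rightarrow> ('o, 'a, 'p, 'b) cat_functor \<Rightarrow> ('o \<Rightarrow> 'b) \<Rightarrow> bool" where
  "natural_transformation C D F G \<eta> \<longleftrightarrow> is_functor C D F \<and> is_functor C D G
    \<and> (\<forall>X \<in> Obj C. \<eta> X \<in> Hom D (OMap F X) (OMap G X))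
    \<and> (\<forall>f \<in> Arr C. Comp D (AMap G f) (\<eta> (Dom C f)) = Comp D (\<eta> (Cod C f)) (AMap F f))"

definition adjunction :: "('o, 'a, 'y) category_scheme \<Rightarrow> ('p, 'b, 'z) category_scheme
    \<Rightarrow> ('o, 'a, 'p, 'b) cat_functor \<Rightarrow> ('p, 'b, 'o, 'a) cat_functor
    \<Rightarrow> ('o \<Rightarrow> 'a) \<Rightarrow> ('p \<Rightarrow> 'b) \<Rightarrow> bool" where
  "adjunction C D F G u c \<longleftrightarrow>
      natural_transformation C C id_functor (G \<circ>\<^sub>F F) u
    \<and> natural_transformation D D (F \<circ>\<^sub>F G) id_functor c
    \<and> is_functor C D F \<and> is_functor D C G
    \<and> (\<forall>X \<in> Obj C. Comp D (c (OMap F X)) (AMap F (u X)) = Ident D (OMap F X))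
    \<and> (\<forall>Y \<in> Obj D. Comp C (AMap G (c Y)) (u (OMap G Y)) = Ident C (OMap G Y))"

definition left_adjoint_functor :: "('o, 'a, 'y) category_scheme \<Rightarrow> ('p, 'b, 'z) category_scheme
    \<Rightarrow> ('o, 'a, 'p, 'b) cat_functor \<Rightarrow> bool" where
  "left_adjoint_functor C D F \<longleftrightarrow> (\<exists>G u c. adjunction C D F G u c)"


definition cone :: "('i, 'j, 'y) category_scheme \<Rightarrow> ('o, 'a, 'z) category_scheme
    \<Rightarrow> ('i, 'j, 'o, 'a) cat_functor \<Rightarrow> 'o \<Rightarrow> ('i \<Rightarrow> 'a) \<Rightarrow> bool" where
  "cone J C D X \<xi> \<longleftrightarrow> X \<in> Obj C \<and> (\<forall>j \<in> Obj J. \<xi> j \<in> Hom C X (OMap D j))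
    \<and> (\<forall>u \<in> Arr J. Comp C (AMap D u) (\<xi> (Dom J u)) = \<xi> (Cod J u))"

definition limit_cone :: "('i, 'j, 'y) category_scheme \<Rightarrow> ('o, 'a, 'z) category_scheme
    \<Rightarrow> ('i, 'j, 'o, 'a) cat_functor \<Rightarrow> 'o \<Rightarrow> ('i \<Rightarrow> 'a) \<Rightarrow> bool" where
  "limit_cone J C D L \<pi> \<longleftrightarrow> cone J C D L \<pi>
    \<and> (\<forall>X \<xi>. cone J C D X \<xi> \<longrightarrow> (\<exists>!h. h \<in> Hom C X L \<and> (\<forall>j \<in> Obj J. Comp C (\<pi> j) h = \<xi> j)))"

definition cocone :: "('i, 'j, 'y) category_scheme \<Rightarrow> ('o, 'a, 'z) category_scheme
    \<Rightarrow> ('i, 'j, 'o, 'a) cat_functor \<Rightarrow> 'o \<Rightarrow> ('i \<Rightarrow> 'a) \<Rightarrow> bool" where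
  "cocone J C D X \<xi> \<longleftrightarrow> X \<in> Obj C \<and> (\<forall>j \<in> Obj J. \<xi> j \<in> Hom C (OMap D j) X)
    \<and> (\<forall>u \<in> Arr J. Comp C (\<xi> (Cod J u)) (AMap D u) = \<xi> (Dom J u))"

definition colimit_cocone :: "('i, 'j, 'y) category_scheme \<Rightarrow> ('o, 'a, 'z) category_scheme
    \<Rightarrow> ('i, 'j, 'o, 'a) cat_functor \<Rightarrow> 'o \<Rightarrow> ('i \<Rightarrow> 'a) \<Rightarrow> bool" where
  "colimit_cocone J C D L \<iota> \<longleftrightarrow> cocone J C D L \<iota>
    \<and> (\<forall>X \<xi>. cocone J C D X \<xi> \<longrightarrow> (\<exists>!h. h \<in> Hom C L X \<and> (\<forall>j \<in> Obj J. Comp C h (\<iota> j) = \<xi> j)))"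

text \<open>
  ``All limits'' means all small limits. Smallness is measured by a cardinal \<open>\<kappa>\<close>: a category
  is small if it has fewer than \<open>\<kappa>\<close> arrows (hence fewer than \<open>\<kappa>\<close> objects). For \<open>\<kappa>\<close> strongly
  inaccessible this is smallness relative to a Grothendieck universe. Every category with
  fewer than \<open>\<kappa>\<close> arrows is isomorphic to one whose objects and arrows are elements of the
  type carrying \<open>\<kappa>\<close>, so it suffices to consider those.
\<close>

definition small_category :: "'u rel \<Rightarrow> ('u, 'u) category \<Rightarrow> bool" where
  "small_category \<kappa> J \<longleftrightarrow> category J \<and> |Arr J| <o \<kappa>"

definition has_all_limits :: "'u rel \<Rightarrow> ('o, 'a, 'z) category_scheme \<Rightarrow> bool" where
  "has_all_limits \<kappa> C \<longleftrightarrow>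
    (\<forall>J D. small_category \<kappa> J \<and> is_functor J C D \<longrightarrow> (\<exists>L \<pi>. limit_cone J C D L \<pi>))"

definition has_all_colimits :: "'u rel \<Rightarrow> ('o, 'a, 'z) category_scheme \<Rightarrow> bool" where
  "has_all_colimits \<kappa> C \<longleftrightarrow>
    (\<forall>J D. small_category \<kappa> J \<and> is_functor J C D \<longrightarrow> (\<exists>L \<iota>. colimit_cocone J C D L \<iota>))"

definition terminal :: "('o, 'a, 'z) category_scheme \<Rightarrow> 'o \<Rightarrow> bool" where
  "terminal C T \<longleftrightarrow> T \<in> Obj C \<and> (\<forall>X \<in> Obj C. \<exists>!f. f \<in> Hom C X T)"

definition pullback_square :: "('o, 'a, 'z) category_scheme \<Rightarrow> 'a \<Rightarrow> 'a \<Rightarrow> 'a \<Rightarrow> 'a \<Rightarrow> bool" where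
  \<comment> \<open>\<open>p'\<close> is the pullback of \<open>p\<close> along \<open>g\<close>, with \<open>g'\<close> the remaining projection\<close>
  "pullback_square C p g p' g' \<longleftrightarrow> (\<exists>X Y Z P.
      p \<in> Hom C X Z \<and> g \<in> Hom C Y Z \<and> p' \<in> Hom C P Y \<and> g' \<in> Hom C P X
    \<and> Comp C p g' = Comp C g p'
    \<and> (\<forall>A. \<forall>x \<in> Hom C A X. \<forall>y \<in> Hom C A Y. Comp C p x = Comp C g y
          \<longrightarrow> (\<exists>!h. h \<in> Hom C A P \<and> Comp C g' h = x \<and> Comp C p' h = y)))"

definition pushout_square :: "('o, 'a, 'z) category_scheme \<Rightarrow> 'a \<Rightarrow> 'a \<Rightarrow> 'a \<Rightarrow> 'a \<Rightarrow> bool" where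
  \<comment> \<open>\<open>i'\<close> is the pushout of \<open>i\<close> along \<open>g\<close>, with \<open>g'\<close> the remaining coprojection\<close>
  "pushout_square C i g i' g' \<longleftrightarrow> (\<exists>X Y Z P.
      i \<in> Hom C Z X \<and> g \<in> Hom C Z Y \<and> i' \<in> Hom C Y P \<and> g' \<in> Hom C X P
    \<and> Comp C g' i = Comp C i' g
    \<and> (\<forall>A. \<forall>x \<in> Hom C X A. \<forall>y \<in> Hom C Y A. Comp C x i = Comp C y g
          \<longrightarrow> (\<exists>!h. h \<in> Hom C P A \<and> Comp C h g' = x \<and> Comp C h i' = y)))"


definition retract_of :: "('o, 'a, 'z) category_scheme \<Rightarrow> 'a \<Rightarrow> 'a \<Rightarrow> bool" where
  "retract_of C f g \<longleftrightarrow> f \<in> Arr C \<and> g \<in> Arr C \<and>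
    (\<exists>i \<in> Hom C (Dom C f) (Dom C g). \<exists>r \<in> Hom C (Dom C g) (Dom C f).
     \<exists>j \<in> Hom C (Cod C f) (Cod C g). \<exists>s \<in> Hom C (Cod C g) (Cod C f).
        Comp C r i = Ident C (Dom C f) \<and> Comp C s j = Ident C (Cod C f)
      \<and> Comp C g i = Comp C j f \<and> Comp C f r = Comp C s g)"

definition closed_under_retracts :: "('o, 'a, 'z) category_scheme \<Rightarrow> 'a set \<Rightarrow> bool" where
  "closed_under_retracts C S \<longleftrightarrow> (\<forall>g \<in> S. \<forall>f. retract_of C f g \<longrightarrow> f \<in> S)"

definition closed_under_pullbacks :: "('o, 'a, 'z) category_scheme \<Rightarrow> 'a set \<Rightarrow> bool" where
  "closed_under_pullbacks C S \<longleftrightarrow> (\<forall>p \<in> S. \<forall>g p' g'. pullback_square C p g p' g' \<longrightarrow> p' \<in> S)"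

definition closed_under_pushouts :: "('o, 'a, 'z) category_scheme \<Rightarrow> 'a set \<Rightarrow> bool" where
  "closed_under_pushouts C S \<longleftrightarrow> (\<forall>i \<in> S. \<forall>g i' g'. pushout_square C i g i' g' \<longrightarrow> i' \<in> S)"

definition two_out_of_three :: "('o, 'a, 'z) category_scheme \<Rightarrow> 'a set \<Rightarrow> bool" where
  "two_out_of_three C S \<longleftrightarrow> (\<forall>f \<in> Arr C. \<forall>g \<in> Arr C. Cod C f = Dom C g \<longrightarrow>
      (f \<in> S \<and> g \<in> S \<longrightarrow> Comp C g f \<in> S)
    \<and> (f \<in> S \<and> Comp C g f \<in> S \<longrightarrow> g \<in> S)
    \<and> (g \<in> S \<and> Comp C g f \<in> S \<longrightarrow> f \<in> S))"

definition lifts_against :: "('o, 'a, 'z) category_scheme \<Rightarrow> 'a \<Rightarrow> 'a \<Rightarrow> bool" where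
  \<comment> \<open>\<open>i\<close> has the left lifting property against \<open>p\<close>\<close>
  "lifts_against C i p \<longleftrightarrow>
    (\<forall>u \<in> Hom C (Dom C i) (Dom C p). \<forall>v \<in> Hom C (Cod C i) (Cod C p).
      Comp C p u = Comp C v i
      \<longrightarrow> (\<exists>h \<in> Hom C (Cod C i) (Dom C p). Comp C h i = u \<and> Comp C p h = v))"

definition factors_through :: "('o, 'a, 'z) category_scheme \<Rightarrow> 'a set \<Rightarrow> 'a set \<Rightarrow> 'a \<Rightarrow> bool" where
  \<comment> \<open>\<open>f\<close> is a map in \<open>L\<close> followed by a map in \<open>R\<close>\<close>
  "factors_through C L R f \<longleftrightarrow> (\<exists>i \<in> L. \<exists>p \<in> R. Cod C i = Dom C p \<and> f = Comp C p i)"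

definition weak_factorization_system ::
    "('o, 'a, 'z) category_scheme \<Rightarrow> 'a set \<Rightarrow> 'a set \<Rightarrow> bool" where
  "weak_factorization_system C L R \<longleftrightarrow>
      L = {i \<in> Arr C. \<forall>p \<in> R. lifts_against C i p}
    \<and> R = {p \<in> Arr C. \<forall>i \<in> L. lifts_against C i p}
    \<and> (\<forall>f \<in> Arr C. factors_through C L R f)"


record ('o, 'a) hcategory = "('o, 'a) category" +
  Cof :: "'a set"
  Weq :: "'a set"
  Fib :: "'a set"

definition structured_homotopical_category :: "'u rel \<Rightarrow> ('o, 'a) hcategory \<Rightarrow> bool" where
  "structured_homotopical_category \<kappa> M \<longleftrightarrow>
      category M \<and> has_all_limits \<kappa> M \<and> has_all_colimits \<kappa> M
    \<and> Cof M \<subseteq> Arr M \<and> Weq M \<subseteq> Arr M \<and> Fib M \<subseteq> Arr M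
    \<and> closed_under_retracts M (Weq M) \<and> two_out_of_three M (Weq M)
    \<and> closed_under_retracts M (Cof M) \<and> closed_under_pushouts M (Cof M)
    \<and> closed_under_retracts M (Fib M) \<and> closed_under_pullbacks M (Fib M)"

definition fibrant :: "('o, 'a) hcategory \<Rightarrow> 'o \<Rightarrow> bool" where
  "fibrant M X \<longleftrightarrow> (\<exists>T. terminal M T \<and> (\<exists>t \<in> Hom M X T. t \<in> Fib M))"

definition core_fibrations :: "('o, 'a) hcategory \<Rightarrow> 'a set" where
  "core_fibrations M = {p \<in> Fib M. fibrant M (Cod M p)}"

definition fresse_right_semimodel_category :: "'u rel \<Rightarrow> ('o, 'a) hcategory \<Rightarrow> bool" where
  "fresse_right_semimodel_category \<kappa> M \<longleftrightarrow>
      structured_homotopical_category \<kappa> M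
    \<and> (\<forall>i \<in> Cof M \<inter> Weq M. \<forall>p \<in> core_fibrations M. lifts_against M i p)
    \<and> (\<forall>i \<in> Cof M. \<forall>p \<in> core_fibrations M \<inter> Weq M. lifts_against M i p)
    \<and> (\<forall>f \<in> Arr M. fibrant M (Cod M f)
          \<longrightarrow> factors_through M (Cof M \<inter> Weq M) (core_fibrations M) f
            \<and> factors_through M (Cof M) (core_fibrations M \<inter> Weq M) f)
    \<and> (\<forall>T. terminal M T \<longrightarrow> fibrant M T)"

definition cospitzweck_right_semimodel_category :: "'u rel \<Rightarrow> ('o, 'a) hcategory \<Rightarrow> bool" where
  "cospitzweck_right_semimodel_category \<kappa> M \<longleftrightarrow>
      fresse_right_semimodel_category \<kappa> M
    \<and> weak_factorization_system M (Cof M) (Fib M \<inter> Weq M)"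

datatype semimodel_type = Fresse | CoSpitzweck

fun right_semimodel_category :: "semimodel_type \<Rightarrow> 'u rel \<Rightarrow> ('o, 'a) hcategory \<Rightarrow> bool" where
  "right_semimodel_category Fresse \<kappa> M = fresse_right_semimodel_category \<kappa> M"
| "right_semimodel_category CoSpitzweck \<kappa> M = cospitzweck_right_semimodel_category \<kappa> M"

definition left_quillen_functor ::
    "('o, 'a) hcategory \<Rightarrow> ('p, 'b) hcategory \<Rightarrow> ('o, 'a, 'p, 'b) cat_functor \<Rightarrow> bool" where
  "left_quillen_functor M N F \<longleftrightarrow> left_adjoint_functor M N F
    \<and> AMap F ` Cof M \<subseteq> Cof N \<and> AMap F ` (Cof M \<inter> Weq M) \<subseteq> Cof N \<inter> Weq N"

definition bf_reflector ::
    "('o, 'a) hcategory \<Rightarrow> ('o, 'a, 'o, 'a) cat_functor \<Rightarrow> ('o \<Rightarrow> 'a) \<Rightarrow> bool" where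
  "bf_reflector M R \<eta> \<longleftrightarrow> is_functor M M R \<and> natural_transformation M M id_functor R \<eta>
    \<and> AMap R ` Weq M \<subseteq> Weq M
    \<and> (\<forall>X \<in> Obj M. AMap R (\<eta> X) \<in> Weq M)
    \<and> (\<forall>X \<in> Obj M. \<eta> (OMap R X) \<in> Weq M)"

definition reflector_equivalences ::
    "('o, 'a) hcategory \<Rightarrow> ('o, 'a, 'o, 'a) cat_functor \<Rightarrow> 'a set" where
  "reflector_equivalences M R = {f \<in> Arr M. AMap R f \<in> Weq M}"

definition reflector_fibrations ::
    "('o, 'a) hcategory \<Rightarrow> ('o, 'a, 'o, 'a) cat_functor \<Rightarrow> 'a set" where
  "reflector_fibrations M R =
    {p \<in> Arr M. \<forall>i \<in> Cof M \<inter> reflector_equivalences M R. lifts_against M i p}"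

definition reflector_localization ::
    "('o, 'a) hcategory \<Rightarrow> ('o, 'a, 'o, 'a) cat_functor \<Rightarrow> ('o, 'a) hcategory" where
  "reflector_localization M R =
    M\<lparr>Weq := reflector_equivalences M R, Fib := reflector_fibrations M R\<rparr>"

text \<open>
  The pair \<open>(L, Q)\<close> is initial among left Quillen functors out of \<open>M\<close> that send \<open>W\<close> to
  equivalences, the targets \<open>N\<close> being of type \<open>k\<close>. HOL cannot quantify over the types of objects
  and arrows of \<open>N\<close> inside a formula, so they are supplied by the \<open>itself\<close> argument; leaving
  them as type variables in a theorem ranges over all \<open>N\<close>.
\<close>

definition left_bousfield_localization ::
    "('p, 'b) hcategory itself \<Rightarrow> semimodel_type \<Rightarrow> 'u rel \<Rightarrow> ('o, 'a) hcategory \<Rightarrow> 'a set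
      \<Rightarrow> ('q, 'c) hcategory \<Rightarrow> ('o, 'a, 'q, 'c) cat_functor \<Rightarrow> bool" where
  "left_bousfield_localization _ k \<kappa> M W L Q \<longleftrightarrow>
      right_semimodel_category k \<kappa> L \<and> left_quillen_functor M L Q \<and> AMap Q ` W \<subseteq> Weq L
    \<and> (\<forall>(N :: ('p, 'b) hcategory) F.
          right_semimodel_category k \<kappa> N \<and> left_quillen_functor M N F \<and> AMap F ` W \<subseteq> Weq N
          \<longrightarrow> (\<exists>G. left_quillen_functor L N G \<and> functor_eq M (G \<circ>\<^sub>F Q) F
                \<and> (\<forall>G'. left_quillen_functor L N G' \<and> functor_eq M (G' \<circ>\<^sub>F Q) F
                      \<longrightarrow> functor_eq L G' G)))"

end

theory Submission
  imports Defs
begin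

text \<open>
  Among maps with fibrant target, core (acyclic) fibrations are the maps with the right lifting
  property against acyclic cofibrations (all cofibrations), by the retract argument. The crux is
  that a core fibration \<open>p\<close> between fibrant objects at which \<open>\<eta>\<close> is an equivalence lies in
  \<open>Fib\<^sub>R\<close>: compare \<open>p\<close> with a fibrant replacement \<open>p2\<close> of \<open>R p\<close>. A lifting problem of
  \<open>i \<in> Cof \<inter> Eq\<^sub>R\<close> against \<open>p\<close> gives one against \<open>p2\<close> that factors through the equivalence
  \<open>R i\<close>, hence has a solution, and solutions can be transported back along the levelwise
  equivalence \<open>p \<rightarrow> p2\<close>, replaced by a roof of acyclic fibrations with a section. A map \<open>X \<rightarrow> Y\<close>
  with \<open>Y\<close> fibrant in the localization is then factored through the pullback to \<open>Y\<close> (up to such a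
  roof) of a fibration replacing \<open>R X \<rightarrow> R Y\<close>. No properness is needed since \<open>Y\<close> and the
  replacements are fibrant.
\<close>

section \<open>Lifting properties in a category\<close>

definition rlp :: "('o, 'a, 'z) category_scheme \<Rightarrow> 'a set \<Rightarrow> 'a set" where
  "rlp C S = {p \<in> Arr C. \<forall>i \<in> S. lifts_against C i p}"

text \<open>The right lifting property of the map from \<open>X\<close> to a terminal object,
  phrased without choosing that object; \<open>rlp_terminal\<close> makes the comparison.\<close>

definition injective_object :: "('o, 'a, 'z) category_scheme \<Rightarrow> 'a set \<Rightarrow> 'o \<Rightarrow> bool" where
  "injective_object C S X \<longleftrightarrow> X \<in> Obj C \<and>
    (\<forall>i \<in> S. \<forall>u \<in> Hom C (Dom C i) X. \<exists>h \<in> Hom C (Cod C i) X. Comp C h i = u)"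

lemma Hom_Arr: "f \<in> Hom C X Y \<Longrightarrow> f \<in> Arr C"
  and Hom_Dom: "f \<in> Hom C X Y \<Longrightarrow> Dom C f = X"
  and Hom_Cod: "f \<in> Hom C X Y \<Longrightarrow> Cod C f = Y"
  by (auto simp: Hom_def)

lemma rlp_antimono: "S \<subseteq> S' \<Longrightarrow> rlp C S' \<subseteq> rlp C S"
  by (auto simp: rlp_def)

lemma rlp_lift:
  assumes "p \<in> rlp C S" "i \<in> S" "i \<in> Hom C A B" "p \<in> Hom C X Y"
    and "u \<in> Hom C A X" "v \<in> Hom C B Y" "Comp C p u = Comp C v i"
  obtains h where "h \<in> Hom C B X" "Comp C h i = u" "Comp C p h = v"
proof -
  have "lifts_against C i p"
    using assms(1,2) by (simp add: rlp_def)
  then show thesis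
    unfolding lifts_against_def Hom_Dom[OF assms(3)] Hom_Cod[OF assms(3)] Hom_Dom[OF assms(4)]
      Hom_Cod[OF assms(4)]
    using assms(5,6,7) that by blast
qed

lemma rlpI:
  assumes "p \<in> Hom C X Y" "S \<subseteq> Arr C"
    and "\<And>i A B u v. i \<in> S \<Longrightarrow> i \<in> Hom C A B \<Longrightarrow> u \<in> Hom C A X \<Longrightarrow> v \<in> Hom C B Y
      \<Longrightarrow> Comp C p u = Comp C v i \<Longrightarrow> \<exists>h \<in> Hom C B X. Comp C h i = u \<and> Comp C p h = v"
  shows "p \<in> rlp C S"
proof -
  have "lifts_against C i p" if i: "i \<in> S" for i
  proof -
    have "i \<in> Hom C (Dom C i) (Cod C i)"
      using i assms(2) by (auto simp: Hom_def)
    then show ?thesis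
      using assms(3)[OF i] Hom_Dom[OF assms(1)] Hom_Cod[OF assms(1)]
      unfolding lifts_against_def by simp
  qed
  then show ?thesis
    using Hom_Arr[OF assms(1)] by (simp add: rlp_def)
qed

lemma injective_object_antimono:
  "injective_object C S' X \<Longrightarrow> S \<subseteq> S' \<Longrightarrow> injective_object C S X"
  unfolding injective_object_def by blast

context category
begin

lemma Hom_Obj:
  assumes "f \<in> Hom C X Y"
  shows "X \<in> Obj C" "Y \<in> Obj C"
  using assms Dom_closed Cod_closed by (auto simp: Hom_def)

lemma comp_eq_left:
  assumes "g \<in> Hom C Y Z" "h \<in> Hom C Z W" "g' \<in> Hom C Y Z'" "h' \<in> Hom C Z' W"
    and "f \<in> Hom C X Y" "h \<cdot> g = h' \<cdot> g'"
  shows "h \<cdot> (g \<cdot> f) = h' \<cdot> (g' \<cdot> f)"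
  using Comp_assoc[OF assms(5,1,2)] Comp_assoc[OF assms(5,3,4)] assms(6) by simp

lemma rlp_comp:
  assumes S: "S \<subseteq> Arr C" and p: "p \<in> rlp C S" "p \<in> Hom C X Y"
    and q: "q \<in> rlp C S" "q \<in> Hom C Y Z"
  shows "q \<cdot> p \<in> rlp C S"
proof (rule rlpI[OF Comp_closed[OF p(2) q(2)] S])
  fix i A B u v
  assume i: "i \<in> S" "i \<in> Hom C A B" and u: "u \<in> Hom C A X" and v: "v \<in> Hom C B Z"
    and eq: "(q \<cdot> p) \<cdot> u = v \<cdot> i"
  have "q \<cdot> (p \<cdot> u) = v \<cdot> i"
    using eq Comp_assoc[OF u p(2) q(2)] by simp
  then obtain h where h: "h \<in> Hom C B Y" "h \<cdot> i = p \<cdot> u" "q \<cdot> h = v"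
    using rlp_lift[OF q(1) i q(2) Comp_closed[OF u p(2)] v] by blast
  obtain k where k: "k \<in> Hom C B X" "k \<cdot> i = u" "p \<cdot> k = h"
    using rlp_lift[OF p(1) i p(2) u h(1)] h(2) by metis
  have "(q \<cdot> p) \<cdot> k = v"
    using Comp_assoc[OF k(1) p(2) q(2)] k(3) h(3) by simp
  with k show "\<exists>h \<in> Hom C B X. h \<cdot> i = u \<and> (q \<cdot> p) \<cdot> h = v" by blast
qed

lemma rlp_pullback:
  assumes S: "S \<subseteq> Arr C" and p: "p \<in> rlp C S" and sq: "pullback_square C p g p' g'"
  shows "p' \<in> rlp C S"
proof -
  obtain X Y Z P where pH: "p \<in> Hom C X Z" and g: "g \<in> Hom C Y Z" and p': "p' \<in> Hom C P Y"
    and g': "g' \<in> Hom C P X" and comm: "p \<cdot> g' = g \<cdot> p'"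
    and univ: "\<And>A x y. x \<in> Hom C A X \<Longrightarrow> y \<in> Hom C A Y \<Longrightarrow> p \<cdot> x = g \<cdot> y
          \<Longrightarrow> \<exists>!h. h \<in> Hom C A P \<and> g' \<cdot> h = x \<and> p' \<cdot> h = y"
    using sq unfolding pullback_square_def by blast
  show ?thesis
  proof (rule rlpI[OF p' S])
    fix i A B u v
    assume i: "i \<in> S" "i \<in> Hom C A B" and u: "u \<in> Hom C A P" and v: "v \<in> Hom C B Y"
      and eq: "p' \<cdot> u = v \<cdot> i"
    have "p \<cdot> (g' \<cdot> u) = g \<cdot> (p' \<cdot> u)"
      using comp_eq_left[OF g' pH p' g u comm] .
    also have "\<dots> = (g \<cdot> v) \<cdot> i"
      using eq Comp_assoc[OF i(2) v g] by simp
    finally obtain h where h: "h \<in> Hom C B X" "h \<cdot> i = g' \<cdot> u" "p \<cdot> h = g \<cdot> v"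
      using rlp_lift[OF p i pH Comp_closed[OF u g'] Comp_closed[OF v g]] by blast
    obtain k where k: "k \<in> Hom C B P" "g' \<cdot> k = h" "p' \<cdot> k = v"
      using univ[OF h(1) v h(3)] by blast
    have "p \<cdot> (g' \<cdot> u) = g \<cdot> (p' \<cdot> u)"
      using comp_eq_left[OF g' pH p' g u comm] .
    from univ[OF Comp_closed[OF u g'] Comp_closed[OF u p'] this]
    have uniq: "\<exists>!h. h \<in> Hom C A P \<and> g' \<cdot> h = g' \<cdot> u \<and> p' \<cdot> h = p' \<cdot> u" .
    have "g' \<cdot> (k \<cdot> i) = g' \<cdot> u" "p' \<cdot> (k \<cdot> i) = p' \<cdot> u"
      using Comp_assoc[OF i(2) k(1) g'] Comp_assoc[OF i(2) k(1) p'] k h eq by simp_all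
    then have "k \<cdot> i = u"
      using uniq u Comp_closed[OF i(2) k(1)] by blast
    with k show "\<exists>h \<in> Hom C B P. h \<cdot> i = u \<and> p' \<cdot> h = v" by blast
  qed
qed

lemma rlp_retract:
  assumes S: "S \<subseteq> Arr C" and g: "g \<in> rlp C S" and ret: "retract_of C f g"
  shows "f \<in> rlp C S"
proof -
  define X Y X' Y' where XY: "X = Dom C f" "Y = Cod C f" "X' = Dom C g" "Y' = Cod C g"
  obtain j r k s where j: "j \<in> Hom C X X'" and r: "r \<in> Hom C X' X" and k: "k \<in> Hom C Y Y'"
    and s: "s \<in> Hom C Y' Y" and eqs: "r \<cdot> j = Ident C X" "s \<cdot> k = Ident C Y"
      "g \<cdot> j = k \<cdot> f" "f \<cdot> r = s \<cdot> g"
    using ret unfolding retract_of_def XY by blast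
  have f: "f \<in> Hom C X Y" and gH: "g \<in> Hom C X' Y'"
    using ret by (auto simp: retract_of_def Hom_def XY)
  show ?thesis
  proof (rule rlpI[OF f S])
    fix i A B u v
    assume i: "i \<in> S" "i \<in> Hom C A B" and u: "u \<in> Hom C A X" and v: "v \<in> Hom C B Y"
      and eq: "f \<cdot> u = v \<cdot> i"
    have "g \<cdot> (j \<cdot> u) = k \<cdot> (f \<cdot> u)"
      using comp_eq_left[OF j gH f k u eqs(3)] .
    also have "\<dots> = (k \<cdot> v) \<cdot> i"
      using eq Comp_assoc[OF i(2) v k] by simp
    finally obtain h where h: "h \<in> Hom C B X'" "h \<cdot> i = j \<cdot> u" "g \<cdot> h = k \<cdot> v"
      using rlp_lift[OF g i gH Comp_closed[OF u j] Comp_closed[OF v k]] by blast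
    have "(r \<cdot> h) \<cdot> i = u"
      using h(2) Comp_assoc[OF i(2) h(1) r] Comp_assoc[OF u j r] eqs(1) Ident_left[OF u] by simp
    moreover have "f \<cdot> (r \<cdot> h) = v"
      using comp_eq_left[OF r f gH s h(1) eqs(4)] h(3) Comp_assoc[OF v k s] eqs(2) Ident_left[OF v]
      by simp
    ultimately show "\<exists>h \<in> Hom C B X. h \<cdot> i = u \<and> f \<cdot> h = v"
      using Comp_closed[OF h(1) r] by blast
  qed
qed

text \<open>A lift in the square with top the identity of \<open>X\<close>, left side
  \<open>i\<close>, right side \<open>f\<close> and bottom \<open>p\<close> is a retraction of
  \<open>i\<close>; together with the identity of \<open>Y\<close> it exhibits \<open>f\<close> as a
  retract of \<open>p\<close>.\<close>

lemma retract_argument: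
  assumes i: "i \<in> Hom C X E" and p: "p \<in> Hom C E Y" and f: "f \<in> rlp C S" "i \<in> S"
    and eq: "f = p \<cdot> i"
  shows "retract_of C f p"
proof -
  have fH: "f \<in> Hom C X Y"
    using eq Comp_closed[OF i p] by simp
  have X: "X \<in> Obj C" and Y: "Y \<in> Obj C"
    using Hom_Obj[OF fH] .
  have "f \<cdot> Ident C X = p \<cdot> i"
    using Ident_right[OF fH] eq by simp
  then obtain r where r: "r \<in> Hom C E X" "r \<cdot> i = Ident C X" "f \<cdot> r = p"
    using rlp_lift[OF f i fH Ident_closed[OF X] p] by blast
  show ?thesis
    unfolding retract_of_def
    using i p r eq fH Ident_closed[OF Y] Ident_left[OF fH] Ident_left[OF p]
      Ident_left[OF Ident_closed[OF Y]]
    by (metis Hom_Arr Hom_Cod Hom_Dom)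
qed

lemma rlp_Ident:
  assumes "S \<subseteq> Arr C" "X \<in> Obj C"
  shows "Ident C X \<in> rlp C S"
proof (rule rlpI[OF Ident_closed[OF assms(2)] assms(1)])
  fix i A B u v
  assume "u \<in> Hom C A X" "v \<in> Hom C B X" "Ident C X \<cdot> u = v \<cdot> i"
  then show "\<exists>h \<in> Hom C B X. h \<cdot> i = u \<and> Ident C X \<cdot> h = v"
    by (auto simp: Ident_left)
qed

lemma injective_object_rlp:
  assumes S: "S \<subseteq> Arr C" and p: "p \<in> rlp C S" "p \<in> Hom C X Y" and Y: "injective_object C S Y"
  shows "injective_object C S X"
  unfolding injective_object_def
proof (intro conjI ballI)
  show "X \<in> Obj C" using Hom_Obj(1)[OF p(2)] .
  fix i u assume i: "i \<in> S" and u: "u \<in> Hom C (Dom C i) X"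
  have iH: "i \<in> Hom C (Dom C i) (Cod C i)"
    using i S by (auto simp: Hom_def)
  obtain v where v: "v \<in> Hom C (Cod C i) Y" "v \<cdot> i = p \<cdot> u"
    using Y i Comp_closed[OF u p(2)] unfolding injective_object_def by blast
  show "\<exists>h \<in> Hom C (Cod C i) X. h \<cdot> i = u"
    using rlp_lift[OF p(1) i iH p(2) u v(1)] v(2) by metis
qed

text \<open>Maps into \<open>T\<close> with the same source agree, so \<open>T\<close> itself is
  injective and the lower triangle of any lift commutes automatically.\<close>

lemma rlp_terminal:
  assumes S: "S \<subseteq> Arr C" and T: "terminal C T" and t: "t \<in> Hom C X T"
  shows "t \<in> rlp C S \<longleftrightarrow> injective_object C S X"
proof
  have "injective_object C S T"
    unfolding injective_object_def
  proof (intro conjI ballI)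
    show TO: "T \<in> Obj C" using T by (simp add: terminal_def)
    fix i u assume i: "i \<in> S" and u: "u \<in> Hom C (Dom C i) T"
    have iH: "i \<in> Hom C (Dom C i) (Cod C i)"
      using i S by (auto simp: Hom_def)
    obtain h where h: "h \<in> Hom C (Cod C i) T"
      using T Hom_Obj[OF iH] unfolding terminal_def by blast
    moreover have "h \<cdot> i = u"
      using T Hom_Obj[OF iH] u Comp_closed[OF iH h] unfolding terminal_def by blast
    ultimately show "\<exists>h \<in> Hom C (Cod C i) T. h \<cdot> i = u" by blast
  qed
  then show "injective_object C S X" if "t \<in> rlp C S"
    using injective_object_rlp[OF S that t] by blast
next
  assume X: "injective_object C S X"
  show "t \<in> rlp C S"
  proof (rule rlpI[OF t S])
    fix i A B u v
    assume i: "i \<in> S" "i \<in> Hom C A B" and u: "u \<in> Hom C A X" and v: "v \<in> Hom C B T"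
    obtain h where h: "h \<in> Hom C B X" "h \<cdot> i = u"
      using X i u unfolding injective_object_def by (metis Hom_Dom Hom_Cod)
    have "t \<cdot> h = v"
      using T Hom_Obj(2)[OF i(2)] Comp_closed[OF h(1) t] v unfolding terminal_def by blast
    with h show "\<exists>h \<in> Hom C B X. h \<cdot> i = u \<and> t \<cdot> h = v" by blast
  qed
qed

end

section \<open>Terminal objects and pullbacks from small limits\<close>

text \<open>\<open>has_all_limits\<close> only sees index categories inside the type carrying
  \<kappa>. A cospan needs five elements there: three objects, doubling as their identities, and two
  further arrows.\<close>

lemma infinite_obtain_5:
  assumes "infinite (A :: 'u set)"
  obtains a b c f g :: 'u where "distinct [a, b, c, f, g]"
proof -
  obtain B where B: "B \<subseteq> A" "finite B" "card B = 5"
    using infinite_arbitrarily_large[OF assms] by metis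
  obtain xs where xs: "set xs = B" "distinct xs"
    using finite_distinct_list[OF B(2)] by blast
  then have "length xs = 5"
    using B(3) distinct_card by metis
  then obtain a b c f g where "xs = [a, b, c, f, g]"
    by (auto simp: numeral_eq_Suc length_Suc_conv)
  with xs that show thesis by blast
qed

context category
begin

text \<open>Limit of the empty diagram. Its index category is small since \<kappa> is infinite, and
  its cones are just objects, with arbitrary values as legs.\<close>

lemma has_terminal:
  fixes \<kappa> :: "'u rel"
  assumes cinf: "Cinfinite \<kappa>" and lim: "has_all_limits \<kappa> C"
  shows "\<exists>T. terminal C T"
proof -
  define J :: "('u, 'u) category" where
    "J = \<lparr>Obj = {}, Arr = {}, Dom = id, Cod = id, Ident = id, Comp = (\<lambda>x y. x)\<rparr>"
  define D :: "('u, 'u, 'o, 'a) cat_functor" where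
    "D = \<lparr>OMap = (\<lambda>_. undefined), AMap = (\<lambda>_. undefined)\<rparr>"
  have J: "category J"
    by unfold_locales (auto simp: J_def Hom_def)
  have "finite (Arr J)"
    by (simp add: J_def)
  then have "small_category \<kappa> J"
    unfolding small_category_def
    using J finite_ordLess_infinite[OF card_of_Well_order, of \<kappa> "Arr J"] cinf
    by (simp add: cinfinite_def Card_order_trans card_order_on_well_order_on Field_card_of)
  moreover have "is_functor J C D"
    using J category_axioms by (simp add: is_functor_def J_def)
  ultimately obtain L \<pi> where L: "limit_cone J C D L \<pi>"
    using lim unfolding has_all_limits_def by blast
  have "\<exists>!f. f \<in> Hom C X L" if "X \<in> Obj C" for X
  proof -
    have "cone J C D X \<pi>"
      using that by (simp add: cone_def J_def)
    then have "\<exists>!h. h \<in> Hom C X L \<and> (\<forall>j \<in> Obj J. Comp C (\<pi> j) h = \<pi> j)"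
      using L unfolding limit_cone_def by blast
    then show ?thesis
      by (simp add: J_def)
  qed
  moreover have "L \<in> Obj C"
    using L by (simp add: limit_cone_def cone_def)
  ultimately have "terminal C L"
    by (simp add: terminal_def)
  then show ?thesis ..
qed

lemma has_pullback:
  fixes \<kappa> :: "'u rel"
  assumes cinf: "Cinfinite \<kappa>" and lim: "has_all_limits \<kappa> C"
    and p: "p \<in> Hom C X Z" and g: "g \<in> Hom C Y Z"
  shows "\<exists>p' g'. pullback_square C p g p' g'"
proof -
  obtain a b c m n :: 'u where dist: "distinct [a, b, c, m, n]"
    using infinite_obtain_5 cinf unfolding cinfinite_def by blast
  have ne: "a \<noteq> b" "a \<noteq> c" "a \<noteq> m" "a \<noteq> n" "b \<noteq> c"
      "b \<noteq> m" "b \<noteq> n" "c \<noteq> m" "c \<noteq> n" "m \<noteq> n"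
    using dist by simp_all
  \<comment> \<open>The cospan a -> c <- b with arrows \<open>m\<close> and \<open>n\<close>. If the
    later factor is \<open>m\<close> or \<open>n\<close>, the earlier one can only be an identity;
    otherwise the later factor is an identity. The formula for \<open>Comp\<close> is associative on
    all elements, composable or not.\<close>
  define J :: "('u, 'u) category" where
    "J = \<lparr>Obj = {a, b, c}, Arr = {a, b, c, m, n},
      Dom = (\<lambda>x. if x = m then a else if x = n then b else x),
      Cod = (\<lambda>x. if x = m \<or> x = n then c else x), Ident = (\<lambda>x. x),
      Comp = (\<lambda>y x. if y = m \<or> y = n then y else x)\<rparr>"
  define D :: "('u, 'u, 'o, 'a) cat_functor" where
    "D = \<lparr>OMap = (\<lambda>x. if x = a then X else if x = b then Y else Z),
      AMap = (\<lambda>x. if x = a then Ident C X else if x = b then Ident C Y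
        else if x = c then Ident C Z else if x = m then p else g)\<rparr>"
  have J: "category J"
  proof
    show "Comp J (Comp J h g) f = Comp J h (Comp J g f)" for f g h
      by (simp add: J_def)
  qed (auto simp: J_def Hom_def ne ne[symmetric])
  have "finite (Arr J)"
    by (simp add: J_def)
  then have "small_category \<kappa> J"
    unfolding small_category_def
    using J finite_ordLess_infinite[OF card_of_Well_order, of \<kappa> "Arr J"] cinf
    by (simp add: cinfinite_def Card_order_trans card_order_on_well_order_on Field_card_of)
  moreover note Obj = Hom_Obj[OF p] Hom_Obj[OF g]
  have "is_functor J C D"
    unfolding is_functor_def
    using J category_axioms p g Obj Obj[THEN Ident_closed] Ident_left[OF p] Ident_left[OF g]
      Ident_right[OF p] Ident_right[OF g] Obj[THEN Ident_closed, THEN Ident_left]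
    by (simp add: J_def D_def ne ne[symmetric])
  ultimately obtain P \<pi> where L: "limit_cone J C D P \<pi>"
    using lim unfolding has_all_limits_def by blast
  \<comment> \<open>The leg at \<open>c\<close> is determined by the other two, so cones are exactly
    the pairs that a pullback has to classify.\<close>
  have cn: "cone J C D A \<xi> \<longleftrightarrow> A \<in> Obj C \<and> \<xi> a \<in> Hom C A X \<and> \<xi> b \<in> Hom C A Y
      \<and> \<xi> c \<in> Hom C A Z \<and> p \<cdot> \<xi> a = \<xi> c \<and> g \<cdot> \<xi> b = \<xi> c" for A \<xi>
    unfolding cone_def using ne ne[symmetric] Ident_left by (auto simp: J_def D_def)
  have P: "\<pi> a \<in> Hom C P X" "\<pi> b \<in> Hom C P Y" "p \<cdot> \<pi> a = g \<cdot> \<pi> b" "p \<cdot> \<pi> a = \<pi> c"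
    using L unfolding limit_cone_def cn by auto
  have "\<exists>!h. h \<in> Hom C A P \<and> \<pi> a \<cdot> h = x \<and> \<pi> b \<cdot> h = y"
    if x: "x \<in> Hom C A X" and y: "y \<in> Hom C A Y" and eq: "p \<cdot> x = g \<cdot> y" for A x y
  proof -
    define \<xi> where "\<xi> = (\<lambda>j. if j = a then x else if j = b then y else p \<cdot> x)"
    have "cone J C D A \<xi>"
      unfolding cn using ne ne[symmetric] x y eq Hom_Obj[OF x] Comp_closed[OF x p] by (auto simp: \<xi>_def)
    then have "\<exists>!h. h \<in> Hom C A P \<and> (\<forall>j \<in> Obj J. \<pi> j \<cdot> h = \<xi> j)"
      using L unfolding limit_cone_def by blast
    moreover have "(\<forall>j \<in> Obj J. \<pi> j \<cdot> h = \<xi> j) \<longleftrightarrow> \<pi> a \<cdot> h = x \<and> \<pi> b \<cdot> h = y"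
      if "h \<in> Hom C A P" for h
      using ne ne[symmetric] P(4) Comp_assoc[OF that P(1) p] by (auto simp: J_def \<xi>_def)
    ultimately show ?thesis by (simp cong: conj_cong)
  qed
  then show ?thesis
    unfolding pullback_square_def using p g P by blast
qed

end

section \<open>Calculus of arrows and of pullback squares\<close>

context category
begin

lemma comp_simps:
  assumes "f \<in> Arr C" "g \<in> Arr C" "Cod C f = Dom C g"
  shows "g \<cdot> f \<in> Arr C" "Dom C (g \<cdot> f) = Dom C f" "Cod C (g \<cdot> f) = Cod C g"
  using Comp_closed[of f "Dom C f" "Dom C g" g "Cod C g"] assms by (auto simp: Hom_def)

lemma comp_assoc_simp:
  assumes "f \<in> Arr C" "g \<in> Arr C" "h \<in> Arr C" "Cod C f = Dom C g" "Cod C g = Dom C h"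
  shows "(h \<cdot> g) \<cdot> f = h \<cdot> (g \<cdot> f)"
  using Comp_assoc[of f "Dom C f" "Dom C g" g "Dom C h" h "Cod C h"] assms by (simp add: Hom_def)

lemma Ident_left_simp: "f \<in> Arr C \<Longrightarrow> Cod C f = X \<Longrightarrow> Ident C X \<cdot> f = f"
  using Ident_left[of f "Dom C f" X] by (simp add: Hom_def)

lemma Ident_right_simp: "f \<in> Arr C \<Longrightarrow> Dom C f = X \<Longrightarrow> f \<cdot> Ident C X = f"
  using Ident_right[of f X "Cod C f"] by (simp add: Hom_def)

lemmas arrow_simps = Hom_def comp_simps comp_assoc_simp Ident_left_simp Ident_right_simp

text \<open>\<open>arrow_simps\<close> associates composites to the right, which hides the factor
  \<open>h \<cdot> g\<close> inside \<open>h \<cdot> (g \<cdot> f)\<close>. This form lets the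
  equation rewrite there too.\<close>

lemma comp_eqD:
  assumes "h \<cdot> g = k" "f \<in> Arr C" "g \<in> Arr C" "h \<in> Arr C" "Cod C f = Dom C g" "Cod C g = Dom C h"
  shows "h \<cdot> (g \<cdot> f) = k \<cdot> f"
  using comp_assoc_simp[OF assms(2-6)] assms(1) by simp

lemma two_out_of_threeD:
  assumes "two_out_of_three C S" "f \<in> Hom C X Y" "g \<in> Hom C Y Z"
  shows "f \<in> S \<Longrightarrow> g \<in> S \<Longrightarrow> g \<cdot> f \<in> S"
    and "f \<in> S \<Longrightarrow> g \<cdot> f \<in> S \<Longrightarrow> g \<in> S"
    and "g \<in> S \<Longrightarrow> g \<cdot> f \<in> S \<Longrightarrow> f \<in> S"
  using assms unfolding two_out_of_three_def Hom_def by auto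

lemma pullback_square_sym:
  assumes "pullback_square C p g p' g'"
  shows "pullback_square C g p g' p'"
proof -
  obtain X Y Z P where H: "p \<in> Hom C X Z" "g \<in> Hom C Y Z" "p' \<in> Hom C P Y" "g' \<in> Hom C P X"
      "p \<cdot> g' = g \<cdot> p'"
    and u: "\<And>A x y. x \<in> Hom C A X \<Longrightarrow> y \<in> Hom C A Y \<Longrightarrow> p \<cdot> x = g \<cdot> y
          \<Longrightarrow> \<exists>!h. h \<in> Hom C A P \<and> g' \<cdot> h = x \<and> p' \<cdot> h = y"
    using assms unfolding pullback_square_def by blast
  have u': "\<exists>!h. h \<in> Hom C A P \<and> p' \<cdot> h = y \<and> g' \<cdot> h = x"
    if "y \<in> Hom C A Y" "x \<in> Hom C A X" "g \<cdot> y = p \<cdot> x" for A x y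
    using u[OF that(2) that(1) that(3)[symmetric]] by (simp add: conj_commute)
  show ?thesis
    unfolding pullback_square_def
    by (rule exI[of _ Y], rule exI[of _ X], rule exI[of _ Z], rule exI[of _ P])
      (use H u' in simp)
qed

lemma pullback_comm: "pullback_square C p g p' g' \<Longrightarrow> p \<cdot> g' = g \<cdot> p'"
  unfolding pullback_square_def by blast

text \<open>The objects in \<open>pullback_square\<close> are existentially bound; the memberships
  in \<open>Hom\<close> pin them down, so that the universal property can be used with named
  objects.\<close>

lemma pullback_universal:
  assumes sq: "pullback_square C p g p' g'"
    and H: "p \<in> Hom C X Z" "g \<in> Hom C Y Z" "p' \<in> Hom C P Y"
    and xy: "x \<in> Hom C A X" "y \<in> Hom C A Y" "p \<cdot> x = g \<cdot> y"
  shows "\<exists>!h. h \<in> Hom C A P \<and> g' \<cdot> h = x \<and> p' \<cdot> h = y"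
proof -
  obtain X' Y' Z' P' where H': "p \<in> Hom C X' Z'" "g \<in> Hom C Y' Z'" "p' \<in> Hom C P' Y'"
    and u: "\<And>A x y. x \<in> Hom C A X' \<Longrightarrow> y \<in> Hom C A Y' \<Longrightarrow> p \<cdot> x = g \<cdot> y
          \<Longrightarrow> \<exists>!h. h \<in> Hom C A P' \<and> g' \<cdot> h = x \<and> p' \<cdot> h = y"
    using sq unfolding pullback_square_def by blast
  have "X' = X" "Y' = Y" "P' = P"
    using H H' by (auto simp: Hom_def)
  with u xy show ?thesis by simp
qed

lemma pullback_pair:
  assumes "pullback_square C p g p' g'" "p \<in> Hom C X Z" "g \<in> Hom C Y Z" "p' \<in> Hom C P Y"
    and "x \<in> Hom C A X" "y \<in> Hom C A Y" "p \<cdot> x = g \<cdot> y"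
  obtains h where "h \<in> Hom C A P" "g' \<cdot> h = x" "p' \<cdot> h = y"
  using pullback_universal[OF assms] by blast

lemma pullback_jointly_monic:
  assumes sq: "pullback_square C p g p' g'"
    and H: "p \<in> Hom C X Z" "g \<in> Hom C Y Z" "p' \<in> Hom C P Y" "g' \<in> Hom C P X"
    and hk: "h \<in> Hom C A P" "k \<in> Hom C A P" "g' \<cdot> h = g' \<cdot> k" "p' \<cdot> h = p' \<cdot> k"
  shows "h = k"
proof -
  have "\<exists>!h. h \<in> Hom C A P \<and> g' \<cdot> h = g' \<cdot> k \<and> p' \<cdot> h = p' \<cdot> k"
    using pullback_universal[OF sq H(1-3) Comp_closed[OF hk(2) H(4)] Comp_closed[OF hk(2) H(3)]]
      comp_eq_left[OF H(4,1,3,2) hk(2) pullback_comm[OF sq]] .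
  with hk show ?thesis by blast
qed

end

section \<open>Fibrant objects of a right semimodel category\<close>

locale fresse =
  fixes \<kappa> :: "'u rel" and M :: "('o, 'a) hcategory" (structure)
  assumes cinf: "Cinfinite \<kappa>" and fresse: "fresse_right_semimodel_category \<kappa> M"
begin

abbreviation ACof :: "'a set" where
  "ACof \<equiv> Cof M \<inter> Weq M"

lemma sh: "structured_homotopical_category \<kappa> M"
  using fresse by (simp add: fresse_right_semimodel_category_def)

end

sublocale fresse \<subseteq> category M
  using sh by (simp add: structured_homotopical_category_def)

context fresse
begin

lemma Weq_two_out_of_three: "two_out_of_three M (Weq M)"
  using sh by (simp add: structured_homotopical_category_def)

lemmas Weq_comp = two_out_of_threeD(1)[OF Weq_two_out_of_three]
  and Weq_left = two_out_of_threeD(2)[OF Weq_two_out_of_three]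
  and Weq_right = two_out_of_threeD(3)[OF Weq_two_out_of_three]

lemma Cof_Arr: "Cof M \<subseteq> Arr M" and Weq_Arr: "Weq M \<subseteq> Arr M" and Fib_Arr: "Fib M \<subseteq> Arr M"
  using sh by (simp_all add: structured_homotopical_category_def)

lemma ACof_Arr: "ACof \<subseteq> Arr M"
  using Cof_Arr by blast

lemma Weq_retract: "retract_of M f g \<Longrightarrow> g \<in> Weq M \<Longrightarrow> f \<in> Weq M"
  using sh unfolding structured_homotopical_category_def closed_under_retracts_def by blast

lemma Fib_retract: "retract_of M f g \<Longrightarrow> g \<in> Fib M \<Longrightarrow> f \<in> Fib M"
  using sh unfolding structured_homotopical_category_def closed_under_retracts_def by blast

lemma terminal_exists: "\<exists>T. terminal M T"
  using has_terminal[OF cinf] sh by (simp add: structured_homotopical_category_def)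

lemma pullback:
  assumes p: "p \<in> Hom M X Z" and g: "g \<in> Hom M Y Z"
  obtains P p' g' where "pullback_square M p g p' g'" "p' \<in> Hom M P Y" "g' \<in> Hom M P X"
proof -
  have "has_all_limits \<kappa> M"
    using sh by (simp add: structured_homotopical_category_def)
  then obtain p' g' where sq: "pullback_square M p g p' g'"
    using has_pullback[OF cinf _ p g] by blast
  then obtain X' Y' Z' P where "p \<in> Hom M X' Z'" "g \<in> Hom M Y' Z'" "p' \<in> Hom M P Y'"
      "g' \<in> Hom M P X'"
    unfolding pullback_square_def by blast
  moreover from this have "X' = X" "Y' = Y"
    using p g by (auto simp: Hom_def)
  ultimately show thesis
    using that[OF sq] by simp
qed

section \<open>Core fibrations, factorizations and fibrancy as lifting properties\<close>

lemma core_fibration_rlp: "p \<in> core_fibrations M \<Longrightarrow> p \<in> rlp M ACof"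
  using fresse Fib_Arr
  by (auto simp: fresse_right_semimodel_category_def rlp_def core_fibrations_def)

lemma acyclic_core_fibration_rlp: "p \<in> core_fibrations M \<Longrightarrow> p \<in> Weq M \<Longrightarrow> p \<in> rlp M (Cof M)"
  using fresse Fib_Arr
  by (auto simp: fresse_right_semimodel_category_def rlp_def core_fibrations_def)

lemma terminal_fibrant: "terminal M T \<Longrightarrow> fibrant M T"
  using fresse by (simp add: fresse_right_semimodel_category_def)

lemma factor_core_fibration:
  assumes f: "f \<in> Hom M X Y" and Y: "fibrant M Y"
  obtains E i p where "i \<in> Hom M X E" "i \<in> Cof M" "i \<in> Weq M" "p \<in> Hom M E Y" "p \<in> Fib M"
    "p \<in> rlp M ACof" "p \<cdot> i = f"
proof -
  have "factors_through M ACof (core_fibrations M) f"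
    using fresse f Y by (auto simp: fresse_right_semimodel_category_def Hom_def)
  then obtain i p where ip: "i \<in> ACof" "p \<in> core_fibrations M" "Cod M i = Dom M p" "f = p \<cdot> i"
    unfolding factors_through_def by blast
  moreover have "i \<in> Arr M" "p \<in> Arr M" "p \<in> Fib M"
    using ip Cof_Arr Fib_Arr by (auto simp: core_fibrations_def)
  ultimately show thesis
    using that[of i "Cod M i" p] f core_fibration_rlp[OF ip(2)] by (auto simp: arrow_simps)
qed

lemma factor_acyclic:
  assumes f: "f \<in> Hom M X Y" and Y: "fibrant M Y"
  obtains E i p where "i \<in> Hom M X E" "i \<in> Cof M" "p \<in> Hom M E Y" "p \<in> Weq M"
    "p \<in> rlp M (Cof M)" "p \<cdot> i = f"
proof -
  have "factors_through M (Cof M) (core_fibrations M \<inter> Weq M) f"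
    using fresse f Y by (auto simp: fresse_right_semimodel_category_def Hom_def)
  then obtain i p where ip: "i \<in> Cof M" "p \<in> core_fibrations M" "p \<in> Weq M"
      "Cod M i = Dom M p" "f = p \<cdot> i"
    unfolding factors_through_def by blast
  moreover have "i \<in> Arr M" "p \<in> Arr M"
    using ip Cof_Arr Fib_Arr by (auto simp: core_fibrations_def)
  ultimately show thesis
    using that[of i "Cod M i" p] f acyclic_core_fibration_rlp[OF ip(2,3)]
    by (auto simp: arrow_simps)
qed

text \<open>A map to a terminal object that is a fibration is a core fibration, because terminal
  objects are fibrant. Conversely, if \<open>X\<close> is injective, the map from \<open>X\<close>
  to \<open>T\<close> lifts against the acyclic cofibration in its own factorization, hence is a
  retract of the fibration in it.\<close>

lemma fibrant_iff_injective: "fibrant M X \<longleftrightarrow> injective_object M ACof X"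
proof
  assume "fibrant M X"
  then obtain T t where t: "terminal M T" "t \<in> Hom M X T" "t \<in> Fib M"
    unfolding fibrant_def by blast
  then have "t \<in> core_fibrations M"
    using terminal_fibrant by (simp add: core_fibrations_def Hom_def)
  then show "injective_object M ACof X"
    using rlp_terminal[OF ACof_Arr t(1,2)] core_fibration_rlp by blast
next
  assume X: "injective_object M ACof X"
  obtain T where T: "terminal M T"
    using terminal_exists by blast
  obtain t where t: "t \<in> Hom M X T"
    using T X unfolding terminal_def injective_object_def by blast
  obtain E i p where i: "i \<in> Hom M X E" "i \<in> Cof M" "i \<in> Weq M" and p: "p \<in> Hom M E T" "p \<in> Fib M"
    and eq: "p \<cdot> i = t"
    using factor_core_fibration[OF t terminal_fibrant[OF T]] by metis
  have "t \<in> rlp M ACof"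
    using rlp_terminal[OF ACof_Arr T t] X by simp
  then have "retract_of M t p"
    using retract_argument[OF i(1) p(1)] i eq by blast
  then have "t \<in> Fib M"
    using Fib_retract p(2) by blast
  then show "fibrant M X"
    using T t unfolding fibrant_def by blast
qed

lemma fibrant_rlp: "p \<in> rlp M ACof \<Longrightarrow> p \<in> Hom M X Y \<Longrightarrow> fibrant M Y \<Longrightarrow> fibrant M X"
  using injective_object_rlp[OF ACof_Arr] by (simp add: fibrant_iff_injective)

lemma rlp_Cof_ACof: "p \<in> rlp M (Cof M) \<Longrightarrow> p \<in> rlp M ACof"
  using rlp_antimono[of ACof "Cof M" M] by blast

text \<open>By 2-out-of-3 the cofibration in a factorization of \<open>p\<close> through
  \<open>q\<close> lies in \<open>W\<close>, so the retract argument makes \<open>p\<close> a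
  retract of \<open>q\<close>. With \<open>W\<close> the equivalences this is
  \<open>acyclic_rlp\<close>; with \<open>W\<close> the R-equivalences it yields a lifting axiom of
  the localization.\<close>

lemma acyclic_retract_argument:
  assumes W: "Weq M \<subseteq> W" "two_out_of_three M W" and p: "p \<in> rlp M (Cof M \<inter> W)" "p \<in> W"
    and pH: "p \<in> Hom M X Y" and Y: "fibrant M Y"
  shows "p \<in> rlp M (Cof M) \<inter> Weq M"
proof -
  obtain E i q where i: "i \<in> Hom M X E" "i \<in> Cof M" and q: "q \<in> Hom M E Y" "q \<in> Weq M"
    "q \<in> rlp M (Cof M)" and eq: "q \<cdot> i = p"
    using factor_acyclic[OF pH Y] by metis
  have "i \<in> W"
    using two_out_of_threeD(3)[OF W(2) i(1) q(1)] q(2) W(1) p(2) eq by blast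
  then have "retract_of M p q"
    using retract_argument[OF i(1) q(1) p(1)] i(2) eq by blast
  then show ?thesis
    using q rlp_retract[OF Cof_Arr] Weq_retract by blast
qed

lemma acyclic_rlp:
  "p \<in> rlp M ACof \<Longrightarrow> p \<in> Weq M \<Longrightarrow> p \<in> Hom M X Y \<Longrightarrow> fibrant M Y \<Longrightarrow> p \<in> rlp M (Cof M)"
  using acyclic_retract_argument[OF order_refl Weq_two_out_of_three] by blast

lemma rlp_Cof_Weq:
  assumes p: "p \<in> rlp M (Cof M)" and pH: "p \<in> Hom M X Y" and Y: "fibrant M Y"
  shows "p \<in> Weq M"
proof -
  obtain E i q where i: "i \<in> Hom M X E" "i \<in> Cof M" and q: "q \<in> Hom M E Y" "q \<in> Weq M"
    and eq: "q \<cdot> i = p"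
    using factor_acyclic[OF pH Y] by metis
  show ?thesis
    using retract_argument[OF i(1) q(1) p i(2) eq[symmetric]] Weq_retract q(2) by blast
qed

lemma fibrant_replacement:
  assumes "X \<in> Obj M"
  obtains Z j where "j \<in> Hom M X Z" "j \<in> Weq M" "fibrant M Z"
proof -
  obtain T where T: "terminal M T"
    using terminal_exists by blast
  obtain t where t: "t \<in> Hom M X T"
    using T assms unfolding terminal_def by blast
  show thesis
    using factor_core_fibration[OF t terminal_fibrant[OF T]] fibrant_rlp terminal_fibrant[OF T] that
    by metis
qed

text \<open>The axioms do not list identities among the equivalences. They follow by 2-out-of-3,
  since a fibrant replacement \<open>j\<close> composed with the identity is again
  \<open>j\<close>.\<close>

lemma Ident_Weq:
  assumes "X \<in> Obj M"
  shows "Ident M X \<in> Weq M"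
proof -
  obtain Z j where j: "j \<in> Hom M X Z" "j \<in> Weq M"
    using fibrant_replacement[OF assms] by metis
  show ?thesis
    using Weq_right[OF Ident_closed[OF assms] j(1) j(2)] Ident_right[OF j(1)] j(2) by simp
qed

text \<open>
  Replace \<open>e\<close> by an acyclic core fibration \<open>A2 \<rightarrow> B2\<close> over \<open>p\<close>, against which \<open>i\<close> lifts.
\<close>

lemma lift_through_equivalence:
  assumes i: "i \<in> Hom M A B" "i \<in> Cof M"
    and p: "p \<in> Hom M V Z" "p \<in> rlp M ACof" and Z: "fibrant M Z"
    and e: "e \<in> Hom M A' B'" "e \<in> Weq M"
    and H: "\<alpha> \<in> Hom M A A'" "\<beta> \<in> Hom M B B'" "\<gamma> \<in> Hom M A' V" "\<delta> \<in> Hom M B' Z"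
    and eqs: "e \<cdot> \<alpha> = \<beta> \<cdot> i" "p \<cdot> \<gamma> = \<delta> \<cdot> e"
  shows "\<exists>l \<in> Hom M B V. l \<cdot> i = \<gamma> \<cdot> \<alpha> \<and> p \<cdot> l = \<delta> \<cdot> \<beta>"
proof -
  \<comment> \<open>\<open>d\<close> replaces \<delta> by a fibration, so that \<open>B2\<close> is
    fibrant, and so is the pullback \<open>Q\<close> of \<open>p\<close> along
    \<open>d\<close>.\<close>
  obtain B2 j d where j: "j \<in> Hom M B' B2" "j \<in> Weq M"
    and d: "d \<in> Hom M B2 Z" "d \<in> rlp M ACof" and dj: "d \<cdot> j = \<delta>"
    using factor_core_fibration[OF H(4) Z] by metis
  have B2: "fibrant M B2"
    using fibrant_rlp[OF d(2,1) Z] .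
  obtain Q p' d' where sq: "pullback_square M p d p' d'"
    and Q: "p' \<in> Hom M Q B2" "d' \<in> Hom M Q V"
    by (rule pullback[OF p(1) d(1)])
  note Q = Q pullback_comm[OF sq] rlp_pullback[OF ACof_Arr p(2) sq]
  have QF: "fibrant M Q"
    using fibrant_rlp[OF Q(4,1) B2] .
  note hom = i(1) p(1) e(1) H j(1) d(1) Q(1,2)
  note simps = hom[THEN Hom_Arr] hom[THEN Hom_Dom] hom[THEN Hom_Cod] arrow_simps
  have "p \<cdot> \<gamma> = d \<cdot> (j \<cdot> e)"
    by (simp add: simps eqs(2) comp_eqD[OF dj])
  then obtain c where c: "c \<in> Hom M A' Q" "d' \<cdot> c = \<gamma>" "p' \<cdot> c = j \<cdot> e"
    using pullback_pair[OF sq p(1) d(1) Q(1) H(3) Comp_closed[OF e(1) j(1)]] by metis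
  \<comment> \<open>\<open>p' \<cdot> r\<close> is the replacement of \<open>e\<close>: precomposed
    with the equivalence \<open>k\<close> it is the equivalence \<open>j \<cdot> e\<close>, and it
    ends at the fibrant object \<open>B2\<close>, so every cofibration lifts against it.\<close>
  obtain A2 k r where k: "k \<in> Hom M A' A2" "k \<in> Weq M"
    and r: "r \<in> Hom M A2 Q" "r \<in> rlp M ACof" and rk: "r \<cdot> k = c"
    using factor_core_fibration[OF c(1) QF] by metis
  note hom = hom c(1) k(1) r(1)
  note simps = hom[THEN Hom_Arr] hom[THEN Hom_Dom] hom[THEN Hom_Cod] arrow_simps
  have prH: "p' \<cdot> r \<in> Hom M A2 B2"
    by (simp add: simps)
  have prk: "(p' \<cdot> r) \<cdot> k = j \<cdot> e"
    by (simp add: simps rk c(3))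
  have "p' \<cdot> r \<in> Weq M"
    using Weq_left[OF k(1) prH k(2)] prk Weq_comp[OF e(1) j(1) e(2) j(2)] by simp
  then have pr: "p' \<cdot> r \<in> rlp M (Cof M)"
    using acyclic_rlp[OF rlp_comp[OF ACof_Arr r(2,1) Q(4,1)] _ prH B2] by blast
  have "(p' \<cdot> r) \<cdot> (k \<cdot> \<alpha>) = (j \<cdot> \<beta>) \<cdot> i"
    using eqs(1) by (simp add: simps comp_eqD[OF rk] comp_eqD[OF c(3)])
  then obtain h where h: "h \<in> Hom M B A2" "h \<cdot> i = k \<cdot> \<alpha>" "(p' \<cdot> r) \<cdot> h = j \<cdot> \<beta>"
    using rlp_lift[OF pr i(2,1) prH Comp_closed[OF H(1) k(1)] Comp_closed[OF H(2) j(1)]] by blast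
  note hom = hom h(1)
  note simps = hom[THEN Hom_Arr] hom[THEN Hom_Dom] hom[THEN Hom_Cod] arrow_simps
  have h3: "p' \<cdot> (r \<cdot> h) = j \<cdot> \<beta>"
    using h(3) by (simp add: simps)
  have "(d' \<cdot> (r \<cdot> h)) \<cdot> i = \<gamma> \<cdot> \<alpha>"
    by (simp add: simps h(2) comp_eqD[OF rk] comp_eqD[OF c(2)])
  moreover have "p \<cdot> (d' \<cdot> (r \<cdot> h)) = \<delta> \<cdot> \<beta>"
    by (simp add: simps comp_eqD[OF Q(3)] h3 comp_eqD[OF dj])
  moreover have "d' \<cdot> (r \<cdot> h) \<in> Hom M B V"
    by (simp add: simps)
  ultimately show ?thesis by blast
qed

text \<open>
  \<open>Y'\<close> is a mapping path object of \<open>w\<close>. Such spans replace pullbacks of equivalences along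
  fibrations below, so that Brown's lemma is not required.
\<close>

lemma acyclic_span:
  assumes Y: "fibrant M Y" and Z: "fibrant M Z" and w: "w \<in> Hom M Y Z" "w \<in> Weq M"
  obtains Y' s t q where "s \<in> Hom M Y Y'" "t \<in> Hom M Y' Y" "q \<in> Hom M Y' Z"
    "t \<in> rlp M (Cof M)" "q \<in> rlp M (Cof M)" "t \<cdot> s = Ident M Y" "q \<cdot> s = w"
proof -
  obtain T where T: "terminal M T"
    using terminal_exists by blast
  have YO: "Y \<in> Obj M"
    using Hom_Obj[OF w(1)] by blast
  obtain y z where yz: "y \<in> Hom M Y T" "z \<in> Hom M Z T"
    using T Hom_Obj[OF w(1)] unfolding terminal_def by blast
  have "y \<in> rlp M ACof" "z \<in> rlp M ACof"
    using rlp_terminal[OF ACof_Arr T] yz Y Z by (simp_all add: fibrant_iff_injective)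
  note yz_rlp = this
  \<comment> \<open>\<open>P\<close> is the product of \<open>Y\<close> and \<open>Z\<close>, as a
    pullback over \<open>T\<close>; the map \<open>c\<close> below is the graph of
    \<open>w\<close>.\<close>
  obtain P p2 p1 where sq: "pullback_square M y z p2 p1"
    and P: "p2 \<in> Hom M P Z" "p1 \<in> Hom M P Y"
    by (rule pullback[OF yz])
  note P = P rlp_pullback[OF ACof_Arr yz_rlp(1) sq]
    rlp_pullback[OF ACof_Arr yz_rlp(2) pullback_square_sym[OF sq]]
  have "y \<cdot> Ident M Y = z \<cdot> w"
    using T YO Comp_closed[OF Ident_closed[OF YO] yz(1)] Comp_closed[OF w(1) yz(2)]
    unfolding terminal_def by blast
  then obtain c where c: "c \<in> Hom M Y P" "p1 \<cdot> c = Ident M Y" "p2 \<cdot> c = w"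
    using pullback_pair[OF sq yz P(1) Ident_closed[OF YO] w(1)] by metis
  obtain Y' s e where s: "s \<in> Hom M Y Y'" "s \<in> Weq M" and e: "e \<in> Hom M Y' P" "e \<in> rlp M ACof"
    and es: "e \<cdot> s = c"
    using factor_core_fibration[OF c(1) fibrant_rlp[OF P(3,1) Z]] by metis
  have H: "p1 \<cdot> e \<in> Hom M Y' Y" "p2 \<cdot> e \<in> Hom M Y' Z"
    using Comp_closed[OF e(1)] P by blast+
  have eqs: "(p1 \<cdot> e) \<cdot> s = Ident M Y" "(p2 \<cdot> e) \<cdot> s = w"
    using Comp_assoc[OF s(1) e(1)] P c es by auto
  \<comment> \<open>Precomposed with the equivalence \<open>s\<close>, the two maps become the
    identity and \<open>w\<close>, so 2-out-of-3 applies.\<close>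
  have "p1 \<cdot> e \<in> Weq M" "p2 \<cdot> e \<in> Weq M"
    using Weq_left[OF s(1) _ s(2)] H eqs Ident_Weq[OF YO] w(2) by metis+
  then have "p1 \<cdot> e \<in> rlp M (Cof M)" "p2 \<cdot> e \<in> rlp M (Cof M)"
    using acyclic_rlp[OF rlp_comp[OF ACof_Arr e(2,1) P(4,2)] _ H(1) Y]
      acyclic_rlp[OF rlp_comp[OF ACof_Arr e(2,1) P(3,1)] _ H(2) Z] by blast+
  with that[OF s(1) H] eqs show thesis by blast
qed

text \<open>
  The levelwise equivalence \<open>(a, b)\<close> factors as a map \<open>p \<rightarrow> p'\<close> with a retraction followed by a map
  \<open>p' \<rightarrow> p2\<close> that is a Reedy acyclic fibration, so the lift for \<open>p2\<close> lifts to \<open>p'\<close> and is then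
  retracted to \<open>p\<close>. Here \<open>p'\<close> is the composite \<open>V' \<rightarrow> N \<rightarrow> N1 \<rightarrow> Z'\<close>.
\<close>

lemma lift_transfer:
  assumes i: "i \<in> Hom M A B" "i \<in> Cof M"
    and p: "p \<in> Hom M V Z" "p \<in> rlp M ACof" and Z: "fibrant M Z"
    and p2: "p2 \<in> Hom M V2 Z2" "p2 \<in> rlp M ACof" and Z2: "fibrant M Z2"
    and a: "a \<in> Hom M V V2" "a \<in> Weq M" and b: "b \<in> Hom M Z Z2" "b \<in> Weq M"
    and ab: "p2 \<cdot> a = b \<cdot> p"
    and u: "u \<in> Hom M A V" and v: "v \<in> Hom M B Z" and uv: "p \<cdot> u = v \<cdot> i"
    and l: "l \<in> Hom M B V2" "l \<cdot> i = a \<cdot> u" "p2 \<cdot> l = b \<cdot> v"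
  shows "\<exists>h \<in> Hom M B V. h \<cdot> i = u \<and> p \<cdot> h = v"
proof -
  obtain Z' s t q where st: "s \<in> Hom M Z Z'" "t \<in> Hom M Z' Z" "q \<in> Hom M Z' Z2"
    "t \<in> rlp M (Cof M)" "q \<in> rlp M (Cof M)" "t \<cdot> s = Ident M Z" "q \<cdot> s = b"
    using acyclic_span[OF Z Z2 b] by metis
  \<comment> \<open>\<open>N1\<close> is the base change of \<open>p2\<close> to \<open>Z'\<close>.
    Its projection \<open>g1\<close> to \<open>V2\<close> is a base change of \<open>q\<close>,
    hence acyclic.\<close>
  obtain N1 p1 g1 where sq1: "pullback_square M p2 q p1 g1"
    and N1: "p1 \<in> Hom M N1 Z'" "g1 \<in> Hom M N1 V2"
    by (rule pullback[OF p2(1) st(3)])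
  note N1 = N1 pullback_comm[OF sq1] rlp_pullback[OF ACof_Arr p2(2) sq1]
    rlp_pullback[OF Cof_Arr st(5) pullback_square_sym[OF sq1]]
  have V2: "fibrant M V2"
    using fibrant_rlp[OF p2(2,1) Z2] .
  have Z': "fibrant M Z'"
    using fibrant_rlp[OF rlp_Cof_ACof[OF st(4)] st(2) Z] .
  have N1F: "fibrant M N1"
    using fibrant_rlp[OF N1(4,1) Z'] .
  have g1W: "g1 \<in> Weq M"
    using rlp_Cof_Weq[OF N1(5,2) V2] .
  have tp1: "t \<cdot> p1 \<in> Hom M N1 Z"
    using Comp_closed[OF N1(1) st(2)] .
  \<comment> \<open>\<open>N\<close> pairs points of \<open>V\<close> and of \<open>N1\<close> over
    the same point of \<open>Z\<close>, so it maps to both.\<close>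
  obtain N n nV where sq2: "pullback_square M p (t \<cdot> p1) n nV"
    and N: "n \<in> Hom M N N1" "nV \<in> Hom M N V"
    by (rule pullback[OF p(1) tp1])
  note N = N pullback_comm[OF sq2] rlp_pullback[OF ACof_Arr p(2) sq2]
  have NF: "fibrant M N"
    using fibrant_rlp[OF N(4,1) N1F] .
  have VO: "V \<in> Obj M"
    using Hom_Obj[OF p(1)] by blast
  note hom = i(1) p(1) p2(1) a(1) b(1) u v l(1) st(1,2,3) N1(1,2) N(1,2) Ident_closed[OF VO]
  note simps = hom[THEN Hom_Arr] hom[THEN Hom_Dom] hom[THEN Hom_Cod] arrow_simps
  have "p2 \<cdot> a = q \<cdot> (s \<cdot> p)"
    by (simp add: simps ab comp_eqD[OF st(7)])
  then obtain c where c: "c \<in> Hom M V N1" "g1 \<cdot> c = a" "p1 \<cdot> c = s \<cdot> p"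
    using pullback_pair[OF sq1 p2(1) st(3) N1(1) a(1) Comp_closed[OF p(1) st(1)]] by metis
  have "p \<cdot> Ident M V = (t \<cdot> p1) \<cdot> c"
    using c by (simp add: simps comp_eqD[OF st(6)])
  then obtain d where d: "d \<in> Hom M V N" "nV \<cdot> d = Ident M V" "n \<cdot> d = c"
    using pullback_pair[OF sq2 p(1) tp1 N(1) Ident_closed[OF VO] c(1)] by metis
  \<comment> \<open>The section \<open>d\<close> of \<open>nV\<close> is replaced by an equivalence
    \<open>k\<close>. Then \<open>n \<cdot> e\<close> is acyclic because \<open>c\<close> is an
    equivalence, and \<open>nV \<cdot> e\<close> is a retraction of \<open>k\<close>.\<close>
  obtain V' k e where k: "k \<in> Hom M V V'" "k \<in> Weq M"
    and e: "e \<in> Hom M V' N" "e \<in> rlp M ACof" and ek: "e \<cdot> k = d"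
    using factor_core_fibration[OF d(1) NF] by metis
  have rH: "n \<cdot> e \<in> Hom M V' N1"
    using Comp_closed[OF e(1) N(1)] .
  have rk: "(n \<cdot> e) \<cdot> k = c"
    using Comp_assoc[OF k(1) e(1) N(1)] ek d(3) by simp
  have "c \<in> Weq M"
    using Weq_right[OF c(1) N1(2) g1W] c(2) a(2) by simp
  then have "n \<cdot> e \<in> Weq M"
    using Weq_left[OF k(1) rH k(2)] rk by simp
  then have r: "n \<cdot> e \<in> rlp M (Cof M)"
    using acyclic_rlp[OF rlp_comp[OF ACof_Arr e(2,1) N(4,1)] _ rH N1F] by blast
  have "p2 \<cdot> l = q \<cdot> (s \<cdot> v)"
    by (simp add: simps l(3) comp_eqD[OF st(7)])
  then obtain m where m: "m \<in> Hom M B N1" "g1 \<cdot> m = l" "p1 \<cdot> m = s \<cdot> v"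
    using pullback_pair[OF sq1 p2(1) st(3) N1(1) l(1) Comp_closed[OF v st(1)]] by metis
  note hom = hom c(1) d(1) k(1) e(1) m(1)
  note simps = hom[THEN Hom_Arr] hom[THEN Hom_Dom] hom[THEN Hom_Cod] arrow_simps
  \<comment> \<open>\<open>m\<close> has components \<open>l\<close> and \<open>s \<cdot> v\<close>,
    while \<open>c\<close> has components \<open>a\<close> and \<open>s \<cdot> p\<close>; comparing
    components reduces the claim to the hypotheses on \<open>l\<close>, \<open>u\<close> and
    \<open>v\<close>.\<close>
  have "m \<cdot> i = c \<cdot> u"
  proof (rule pullback_jointly_monic[OF sq1 p2(1) st(3) N1(1,2)
        Comp_closed[OF i(1) m(1)] Comp_closed[OF u c(1)]])
    show "g1 \<cdot> (m \<cdot> i) = g1 \<cdot> (c \<cdot> u)"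
      by (simp add: simps comp_eqD[OF m(2)] comp_eqD[OF c(2)] l(2))
    show "p1 \<cdot> (m \<cdot> i) = p1 \<cdot> (c \<cdot> u)"
      by (simp add: simps comp_eqD[OF m(3)] comp_eqD[OF c(3)] uv)
  qed
  moreover have "(n \<cdot> e) \<cdot> (k \<cdot> u) = c \<cdot> u"
    by (simp add: simps comp_eqD[OF ek] comp_eqD[OF d(3)])
  ultimately obtain h where h: "h \<in> Hom M B V'" "h \<cdot> i = k \<cdot> u" "(n \<cdot> e) \<cdot> h = m"
    using rlp_lift[OF r i(2,1) rH Comp_closed[OF u k(1)] m(1)] by metis
  note hom = hom h(1)
  note simps = hom[THEN Hom_Arr] hom[THEN Hom_Dom] hom[THEN Hom_Cod] arrow_simps
  have h3: "n \<cdot> (e \<cdot> h) = m"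
    using h(3) by (simp add: simps)
  have "(nV \<cdot> (e \<cdot> h)) \<cdot> i = u"
    by (simp add: simps h(2) comp_eqD[OF ek] comp_eqD[OF d(2)])
  moreover have "p \<cdot> (nV \<cdot> (e \<cdot> h)) = v"
    by (simp add: simps comp_eqD[OF N(3)] h3 m(3) comp_eqD[OF st(6)])
  moreover have "nV \<cdot> (e \<cdot> h) \<in> Hom M B V"
    by (simp add: simps)
  ultimately show ?thesis by blast
qed

end

section \<open>The localization\<close>

lemma retract_of_AMap:
  assumes F: "is_functor C D F" and ret: "retract_of C f g"
  shows "retract_of D (AMap F f) (AMap F g)"
proof -
  interpret C: category C using F by (simp add: is_functor_def)
  have FH: "AMap F h \<in> Hom D (OMap F X) (OMap F Y)" if "h \<in> Hom C X Y" for h X Y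
    using F that by (auto simp: is_functor_def Hom_def)
  have Fc: "AMap F (Comp C h h') = Comp D (AMap F h) (AMap F h')"
    if "h' \<in> Hom C X Y" "h \<in> Hom C Y Z" for h h' X Y Z
    using F that by (auto simp: is_functor_def Hom_def)
  have FI: "AMap F (Ident C X) = Ident D (OMap F X)" if "X \<in> Obj C" for X
    using F that by (simp add: is_functor_def)
  define X Y X' Y' where XY: "X = Dom C f" "Y = Cod C f" "X' = Dom C g" "Y' = Cod C g"
  have f: "f \<in> Hom C X Y" and g: "g \<in> Hom C X' Y'"
    using ret by (auto simp: retract_of_def Hom_def XY)
  obtain j r k s where j: "j \<in> Hom C X X'" and r: "r \<in> Hom C X' X" and k: "k \<in> Hom C Y Y'"
    and s: "s \<in> Hom C Y' Y" and eqs: "Comp C r j = Ident C X" "Comp C s k = Ident C Y"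
      "Comp C g j = Comp C k f" "Comp C f r = Comp C s g"
    using ret unfolding retract_of_def XY by blast
  note Ff = FH[OF f] and Fg = FH[OF g]
  show ?thesis
    unfolding retract_of_def Hom_Dom[OF Ff] Hom_Cod[OF Ff] Hom_Dom[OF Fg] Hom_Cod[OF Fg]
  proof (intro conjI)
    show "\<exists>i\<in>Hom D (OMap F X) (OMap F X'). \<exists>r\<in>Hom D (OMap F X') (OMap F X).
      \<exists>j\<in>Hom D (OMap F Y) (OMap F Y'). \<exists>s\<in>Hom D (OMap F Y') (OMap F Y).
        Comp D r i = Ident D (OMap F X) \<and> Comp D s j = Ident D (OMap F Y)
        \<and> Comp D (AMap F g) i = Comp D j (AMap F f) \<and> Comp D (AMap F f) r = Comp D s (AMap F g)"
      by (rule bexI[OF _ FH[OF j]], rule bexI[OF _ FH[OF r]], rule bexI[OF _ FH[OF k]],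
          rule bexI[OF _ FH[OF s]])
        (use FI[OF C.Hom_Obj(1)[OF f]] FI[OF C.Hom_Obj(2)[OF f]]
          Fc[OF j r] Fc[OF k s] Fc[OF j g] Fc[OF f k] Fc[OF r f] Fc[OF g s] eqs in simp)
  qed (use Ff Fg in \<open>auto simp: Hom_def\<close>)
qed

section \<open>The class of R-equivalences\<close>

locale reflected_fresse = fresse \<kappa> M
  for \<kappa> :: "'u rel" and M :: "('o, 'a) hcategory" (structure) +
  fixes R :: "('o, 'a, 'o, 'a) cat_functor" and \<eta> :: "'o \<Rightarrow> 'a"
  assumes reflector: "bf_reflector M R \<eta>"
begin

abbreviation WR :: "'a set" where
  "WR \<equiv> reflector_equivalences M R"

lemma R_functor: "is_functor M M R"
  using reflector by (simp add: bf_reflector_def)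

lemma R_Hom: "f \<in> Hom M X Y \<Longrightarrow> AMap R f \<in> Hom M (OMap R X) (OMap R Y)"
  using R_functor by (auto simp: is_functor_def Hom_def)

lemma R_comp: "f \<in> Hom M X Y \<Longrightarrow> g \<in> Hom M Y Z \<Longrightarrow> AMap R (g \<cdot> f) = AMap R g \<cdot> AMap R f"
  using R_functor by (auto simp: is_functor_def Hom_def)

lemma R_Weq: "f \<in> Weq M \<Longrightarrow> AMap R f \<in> Weq M"
  using reflector by (auto simp: bf_reflector_def)

lemma unit_Hom: "X \<in> Obj M \<Longrightarrow> \<eta> X \<in> Hom M X (OMap R X)"
  using reflector by (simp add: bf_reflector_def natural_transformation_def id_functor_def)

lemma unit_natural: "f \<in> Hom M X Y \<Longrightarrow> AMap R f \<cdot> \<eta> X = \<eta> Y \<cdot> f"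
  using reflector
  by (auto simp: bf_reflector_def natural_transformation_def id_functor_def Hom_def)

lemma unit_WR: "X \<in> Obj M \<Longrightarrow> \<eta> X \<in> WR"
  using reflector unit_Hom[of X] by (simp add: bf_reflector_def reflector_equivalences_def Hom_def)

lemma unit_reflected: "X \<in> Obj M \<Longrightarrow> \<eta> (OMap R X) \<in> Weq M"
  using reflector by (simp add: bf_reflector_def)

lemma Weq_WR: "Weq M \<subseteq> WR"
  using R_Weq Weq_Arr by (auto simp: reflector_equivalences_def)

lemma WR_Arr: "WR \<subseteq> Arr M"
  by (auto simp: reflector_equivalences_def)

lemma WR_two_out_of_three: "two_out_of_three M WR"
  unfolding two_out_of_three_def
proof (intro ballI impI)
  fix f g assume "f \<in> Arr M" "g \<in> Arr M" "Cod M f = Dom M g"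
  then have f: "f \<in> Hom M (Dom M f) (Dom M g)" and g: "g \<in> Hom M (Dom M g) (Cod M g)"
    by (auto simp: Hom_def)
  show "(f \<in> WR \<and> g \<in> WR \<longrightarrow> g \<cdot> f \<in> WR) \<and> (f \<in> WR \<and> g \<cdot> f \<in> WR \<longrightarrow> g \<in> WR)
      \<and> (g \<in> WR \<and> g \<cdot> f \<in> WR \<longrightarrow> f \<in> WR)"
    using f g Comp_closed[OF f g] R_comp[OF f g] Weq_comp[OF R_Hom[OF f] R_Hom[OF g]]
      Weq_left[OF R_Hom[OF f] R_Hom[OF g]] Weq_right[OF R_Hom[OF f] R_Hom[OF g]]
    by (auto simp: reflector_equivalences_def Hom_def)
qed

lemmas WR_comp = two_out_of_threeD(1)[OF WR_two_out_of_three]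
  and WR_right = two_out_of_threeD(3)[OF WR_two_out_of_three]

lemma WR_retract: "retract_of M f g \<Longrightarrow> g \<in> WR \<Longrightarrow> f \<in> WR"
  using Weq_retract[OF retract_of_AMap[OF R_functor]]
  by (simp add: reflector_equivalences_def) (simp add: retract_of_def)

section \<open>Local objects and fibrations of the localization\<close>

abbreviation CofR :: "'a set" where
  "CofR \<equiv> Cof M \<inter> WR"

lemma CofR_Arr: "CofR \<subseteq> Arr M"
  using Cof_Arr by blast

lemma rlp_CofR_ACof: "p \<in> rlp M CofR \<Longrightarrow> p \<in> rlp M ACof"
  using rlp_antimono[of ACof CofR M] Weq_WR by blast

lemma rlp_Cof_CofR: "p \<in> rlp M (Cof M) \<Longrightarrow> p \<in> rlp M CofR"
  using rlp_antimono[of CofR "Cof M" M] by blast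

lemma injective_CofR_fibrant: "injective_object M CofR X \<Longrightarrow> fibrant M X"
  using injective_object_antimono[of M CofR X ACof] Weq_WR by (auto simp: fibrant_iff_injective)

text \<open>2-out-of-3 in the naturality square of \<eta> at \<open>f\<close>, where
  \<open>R f\<close> is an equivalence because R is homotopical. An object at which \<eta> is an
  equivalence plays the role of a local object.\<close>

lemma local_iff:
  assumes f: "f \<in> Hom M X Y" "f \<in> Weq M"
  shows "\<eta> X \<in> Weq M \<longleftrightarrow> \<eta> Y \<in> Weq M"
proof -
  note X = unit_Hom[OF Hom_Obj(1)[OF f(1)]] and Y = unit_Hom[OF Hom_Obj(2)[OF f(1)]]
  show ?thesis
  proof
    assume "\<eta> X \<in> Weq M"
    then have "\<eta> Y \<cdot> f \<in> Weq M"
      using Weq_comp[OF X R_Hom[OF f(1)] _ R_Weq[OF f(2)]] unit_natural[OF f(1)] by simp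
    then show "\<eta> Y \<in> Weq M"
      using Weq_left[OF f(1) Y f(2)] by blast
  next
    assume "\<eta> Y \<in> Weq M"
    then have "AMap R f \<cdot> \<eta> X \<in> Weq M"
      using Weq_comp[OF f(1) Y f(2)] unit_natural[OF f(1)] by simp
    then show "\<eta> X \<in> Weq M"
      using Weq_right[OF X R_Hom[OF f(1)] R_Weq[OF f(2)]] by blast
  qed
qed

text \<open>The hypotheses on \<eta> make the comparison from \<open>p\<close> to the replacement
  \<open>p2\<close> of \<open>R p\<close> a levelwise equivalence, as \<open>lift_transfer\<close>
  demands.\<close>

lemma local_fibration:
  assumes p: "p \<in> Hom M V Z" "p \<in> rlp M ACof" and Z: "fibrant M Z"
    and loc: "\<eta> V \<in> Weq M" "\<eta> Z \<in> Weq M"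
  shows "p \<in> rlp M CofR"
proof (rule rlpI[OF p(1) CofR_Arr])
  fix i A B u v
  assume i: "i \<in> CofR" "i \<in> Hom M A B" and u: "u \<in> Hom M A V" and v: "v \<in> Hom M B Z"
    and uv: "p \<cdot> u = v \<cdot> i"
  have \<eta>V: "\<eta> V \<in> Hom M V (OMap R V)" and \<eta>Z: "\<eta> Z \<in> Hom M Z (OMap R Z)"
    using unit_Hom Hom_Obj[OF p(1)] by auto
  have \<eta>A: "\<eta> A \<in> Hom M A (OMap R A)" and \<eta>B: "\<eta> B \<in> Hom M B (OMap R B)"
    using unit_Hom Hom_Obj[OF i(2)] by auto
  obtain Z2 j where j: "j \<in> Hom M (OMap R Z) Z2" "j \<in> Weq M" and Z2: "fibrant M Z2"
    using fibrant_replacement[OF Hom_Obj(2)[OF \<eta>Z]] by metis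
  obtain V2 k p2 where k: "k \<in> Hom M (OMap R V) V2" "k \<in> Weq M"
    and p2: "p2 \<in> Hom M V2 Z2" "p2 \<in> rlp M ACof" and p2k: "p2 \<cdot> k = j \<cdot> AMap R p"
    using factor_core_fibration[OF Comp_closed[OF R_Hom[OF p(1)] j(1)] Z2] by metis
  note hom = i(2) p(1) u v \<eta>V \<eta>Z \<eta>A \<eta>B j(1) k(1) p2(1)
    i(2)[THEN R_Hom] p(1)[THEN R_Hom] u[THEN R_Hom] v[THEN R_Hom]
  note simps = hom[THEN Hom_Arr] hom[THEN Hom_Dom] hom[THEN Hom_Cod] arrow_simps
  have Ruv: "AMap R p \<cdot> AMap R u = AMap R v \<cdot> AMap R i"
    using R_comp[OF u p(1)] R_comp[OF i(2) v] uv by simp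
  \<comment> \<open>Precomposing this square with \<eta> at \<open>A\<close> and \<open>B\<close>
    gives a lifting problem for \<open>i\<close> that factors through the equivalence
    \<open>R i\<close>.\<close>
  have "p2 \<cdot> (k \<cdot> AMap R u) = (j \<cdot> AMap R v) \<cdot> AMap R i"
    by (simp add: simps comp_eqD[OF p2k] Ruv)
  moreover have "AMap R i \<in> Weq M"
    using i(1) by (simp add: reflector_equivalences_def)
  ultimately obtain l where l: "l \<in> Hom M B V2" "l \<cdot> i = (k \<cdot> AMap R u) \<cdot> \<eta> A"
      "p2 \<cdot> l = (j \<cdot> AMap R v) \<cdot> \<eta> B"
    using lift_through_equivalence[OF i(2) _ p2 Z2 R_Hom[OF i(2)] _ \<eta>A \<eta>B
        Comp_closed[OF R_Hom[OF u] k(1)] Comp_closed[OF R_Hom[OF v] j(1)] unit_natural[OF i(2)]]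
      i(1) by blast
  have "p2 \<cdot> (k \<cdot> \<eta> V) = (j \<cdot> \<eta> Z) \<cdot> p"
    by (simp add: simps comp_eqD[OF p2k] unit_natural[OF p(1)])
  moreover have "l \<cdot> i = (k \<cdot> \<eta> V) \<cdot> u" "p2 \<cdot> l = (j \<cdot> \<eta> Z) \<cdot> v"
    by (simp_all add: l(2,3)) (simp_all add: simps unit_natural[OF u] unit_natural[OF v])
  ultimately show "\<exists>h \<in> Hom M B V. h \<cdot> i = u \<and> p \<cdot> h = v"
    using lift_transfer[OF i(2) _ p Z p2 Z2 Comp_closed[OF \<eta>V k(1)] Weq_comp[OF \<eta>V k(1) loc(1) k(2)]
        Comp_closed[OF \<eta>Z j(1)] Weq_comp[OF \<eta>Z j(1) loc(2) j(2)] _ u v uv l(1)] i(1) by blast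
qed

text \<open>
  \<open>\<eta> Y\<close> is a retract of \<open>\<eta> E\<close>, where \<open>E\<close> is equivalent to \<open>R Y\<close>.
\<close>

lemma injective_CofR_local:
  assumes Y: "injective_object M CofR Y"
  shows "\<eta> Y \<in> Weq M"
proof -
  have YO: "Y \<in> Obj M"
    using Y by (simp add: injective_object_def)
  note \<eta>Y = unit_Hom[OF YO]
  obtain Z j where j: "j \<in> Hom M (OMap R Y) Z" "j \<in> Weq M" and Z: "fibrant M Z"
    using fibrant_replacement[OF Hom_Obj(2)[OF \<eta>Y]] by metis
  \<comment> \<open>Up to the equivalence \<open>q\<close>, the cofibration \<open>i\<close> is the
    map from \<open>Y\<close> to the replacement of \<open>R Y\<close>. It is therefore an
    R-equivalence, and injectivity of \<open>Y\<close> splits it.\<close>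
  obtain E i q where i: "i \<in> Hom M Y E" "i \<in> Cof M" and q: "q \<in> Hom M E Z" "q \<in> Weq M"
    and qi: "q \<cdot> i = j \<cdot> \<eta> Y"
    using factor_acyclic[OF Comp_closed[OF \<eta>Y j(1)] Z] by metis
  have "j \<cdot> \<eta> Y \<in> WR"
    using WR_comp[OF \<eta>Y j(1) unit_WR[OF YO]] j(2) Weq_WR by blast
  then have "i \<in> WR"
    using WR_right[OF i(1) q(1)] q(2) Weq_WR qi by auto
  then have iR: "i \<in> CofR"
    using i(2) by blast
  have "Ident M Y \<in> Hom M (Dom M i) Y"
    using Ident_closed[OF YO] Hom_Dom[OF i(1)] by simp
  then obtain r where "r \<in> Hom M (Cod M i) Y" and ri: "r \<cdot> i = Ident M Y"
    using Y iR unfolding injective_object_def by blast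
  then have r: "r \<in> Hom M E Y"
    using Hom_Cod[OF i(1)] by simp
  \<comment> \<open>The unit at \<open>R Y\<close> is an equivalence; \<open>local_iff\<close>
    carries this along \<open>j\<close> and \<open>q\<close> to \<open>E\<close>.\<close>
  have "\<eta> E \<in> Weq M"
    using local_iff[OF q] local_iff[OF j] unit_reflected[OF YO] by simp
  moreover have "retract_of M (\<eta> Y) (\<eta> E)"
  proof -
    note \<eta>E = unit_Hom[OF Hom_Obj(2)[OF i(1)]]
    have Rri: "AMap R r \<cdot> AMap R i = Ident M (OMap R Y)"
      using R_comp[OF i(1) r] ri R_functor YO by (simp add: is_functor_def)
    show ?thesis
      unfolding retract_of_def Hom_Dom[OF \<eta>Y] Hom_Cod[OF \<eta>Y] Hom_Dom[OF \<eta>E] Hom_Cod[OF \<eta>E]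
    proof (intro conjI)
      show "\<exists>i'\<in>Hom M Y E. \<exists>r'\<in>Hom M E Y. \<exists>j'\<in>Hom M (OMap R Y) (OMap R E).
          \<exists>s\<in>Hom M (OMap R E) (OMap R Y). r' \<cdot> i' = Ident M Y \<and> s \<cdot> j' = Ident M (OMap R Y)
            \<and> \<eta> E \<cdot> i' = j' \<cdot> \<eta> Y \<and> \<eta> Y \<cdot> r' = s \<cdot> \<eta> E"
        by (rule bexI[OF _ i(1)], rule bexI[OF _ r], rule bexI[OF _ R_Hom[OF i(1)]],
            rule bexI[OF _ R_Hom[OF r]])
          (simp add: ri Rri unit_natural[OF i(1)] unit_natural[OF r])
    qed (use \<eta>Y \<eta>E in \<open>auto simp: Hom_def\<close>)
  qed
  ultimately show ?thesis
    using Weq_retract by blast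
qed

text \<open>\<open>f\<close> is first written as an R-equivalence \<open>d\<close> into a pullback
  \<open>P\<close> followed by a map in \<open>rlp M CofR\<close>. Factoring \<open>d\<close> into a
  cofibration and an acyclic fibration then suffices, since 2-out-of-3 makes the cofibration an
  R-equivalence.\<close>

lemma factor_localized:
  assumes f: "f \<in> Hom M X Y" and Y: "injective_object M CofR Y"
  obtains E c g where "c \<in> Hom M X E" "c \<in> CofR" "g \<in> Hom M E Y" "g \<in> rlp M CofR" "g \<cdot> c = f"
proof -
  have YF: "fibrant M Y"
    using injective_CofR_fibrant[OF Y] .
  have XO: "X \<in> Obj M" and YO: "Y \<in> Obj M"
    using Hom_Obj[OF f] .
  note \<eta>X = unit_Hom[OF XO] and \<eta>Y = unit_Hom[OF YO]
  obtain Z j where j: "j \<in> Hom M (OMap R Y) Z" "j \<in> Weq M" and Z: "fibrant M Z"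
    using fibrant_replacement[OF Hom_Obj(2)[OF \<eta>Y]] by metis
  have w: "j \<cdot> \<eta> Y \<in> Hom M Y Z" "j \<cdot> \<eta> Y \<in> Weq M"
    using Comp_closed[OF \<eta>Y j(1)] Weq_comp[OF \<eta>Y j(1) injective_CofR_local[OF Y] j(2)] .
  obtain V k p where k: "k \<in> Hom M (OMap R X) V" "k \<in> Weq M"
    and p: "p \<in> Hom M V Z" "p \<in> rlp M ACof" and pk: "p \<cdot> k = j \<cdot> AMap R f"
    using factor_core_fibration[OF Comp_closed[OF R_Hom[OF f] j(1)] Z] by metis
  \<comment> \<open>\<open>V\<close> and \<open>Z\<close> are equivalent to \<open>R X\<close> and
    \<open>R Y\<close>, at which the unit is an equivalence.\<close>
  have pR: "p \<in> rlp M CofR"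
    using local_fibration[OF p Z] local_iff[OF k] local_iff[OF j]
      unit_reflected[OF XO] unit_reflected[OF YO] by simp
  obtain Y' s t q where st: "s \<in> Hom M Y Y'" "t \<in> Hom M Y' Y" "q \<in> Hom M Y' Z"
    "t \<in> rlp M (Cof M)" "q \<in> rlp M (Cof M)" "t \<cdot> s = Ident M Y" "q \<cdot> s = j \<cdot> \<eta> Y"
    using acyclic_span[OF YF Z w] by metis
  \<comment> \<open>Pulling back along the leg \<open>q\<close> of the span, rather than along
    \<open>j \<cdot> \<eta> Y\<close>, makes \<open>g'\<close> acyclic; \<open>t\<close> later leads
    back from \<open>Y'\<close> to \<open>Y\<close>.\<close>
  obtain P p' g' where sq: "pullback_square M p q p' g'"
    and P: "p' \<in> Hom M P Y'" "g' \<in> Hom M P V"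
    by (rule pullback[OF p(1) st(3)])
  have p': "p' \<in> rlp M CofR"
    using rlp_pullback[OF CofR_Arr pR sq] .
  have "g' \<in> rlp M (Cof M)"
    using rlp_pullback[OF Cof_Arr st(5) pullback_square_sym[OF sq]] .
  then have g'W: "g' \<in> Weq M"
    using rlp_Cof_Weq[OF _ P(2) fibrant_rlp[OF p(2,1) Z]] by blast
  have PF: "fibrant M P"
    using fibrant_rlp[OF rlp_CofR_ACof[OF p'] P(1) fibrant_rlp[OF rlp_Cof_ACof[OF st(4)] st(2) YF]] .
  note hom = f \<eta>X \<eta>Y j(1) k(1) p(1) R_Hom[OF f] st(1,2,3) P Ident_closed[OF YO]
  note simps = hom[THEN Hom_Arr] hom[THEN Hom_Dom] hom[THEN Hom_Cod] arrow_simps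
  have "p \<cdot> (k \<cdot> \<eta> X) = q \<cdot> (s \<cdot> f)"
    by (simp add: simps comp_eqD[OF pk] unit_natural[OF f] comp_eqD[OF st(7)])
  then obtain d where d: "d \<in> Hom M X P" "g' \<cdot> d = k \<cdot> \<eta> X" "p' \<cdot> d = s \<cdot> f"
    using pullback_pair[OF sq p(1) st(3) P(1) Comp_closed[OF \<eta>X k(1)] Comp_closed[OF f st(1)]]
    by metis
  have "k \<cdot> \<eta> X \<in> WR"
    using WR_comp[OF \<eta>X k(1) unit_WR[OF XO]] k(2) Weq_WR by blast
  then have dR: "d \<in> WR"
    using WR_right[OF d(1) P(2)] g'W Weq_WR d(2) by auto
  obtain E c e where c: "c \<in> Hom M X E" "c \<in> Cof M" and e: "e \<in> Hom M E P" "e \<in> Weq M"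
    "e \<in> rlp M (Cof M)" and ec: "e \<cdot> c = d"
    using factor_acyclic[OF d(1) PF] by metis
  have cR: "c \<in> CofR"
    using WR_right[OF c(1) e(1)] e(2) Weq_WR dR ec c(2) by auto
  have tp': "t \<cdot> p' \<in> Hom M P Y" "t \<cdot> p' \<in> rlp M CofR"
    using Comp_closed[OF P(1) st(2)] rlp_comp[OF CofR_Arr p' P(1) rlp_Cof_CofR[OF st(4)] st(2)] .
  have g: "(t \<cdot> p') \<cdot> e \<in> Hom M E Y" "(t \<cdot> p') \<cdot> e \<in> rlp M CofR"
    using Comp_closed[OF e(1) tp'(1)] rlp_comp[OF CofR_Arr rlp_Cof_CofR[OF e(3)] e(1) tp'(2,1)] .
  note hom = hom c(1) e(1) d(1)
  note simps = hom[THEN Hom_Arr] hom[THEN Hom_Dom] hom[THEN Hom_Cod] arrow_simps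
  have "((t \<cdot> p') \<cdot> e) \<cdot> c = f"
    by (simp add: simps ec d(3) comp_eqD[OF st(6)])
  with that[OF c(1) cR g] show thesis .
qed

section \<open>The localized structure and its axioms\<close>

abbreviation L :: "('o, 'a) hcategory" where
  "L \<equiv> reflector_localization M R"

text \<open>Only the equivalences and the fibrations change, so the purely categorical notions carry
  over from \<open>M\<close>.\<close>

lemma L_simps [simp]:
  "Obj L = Obj M" "Arr L = Arr M" "Dom L = Dom M" "Cod L = Cod M" "Ident L = Ident M"
  "Comp L = Comp M" "Cof L = Cof M" "Weq L = WR" "Fib L = rlp M CofR"
  by (simp_all add: reflector_localization_def reflector_fibrations_def rlp_def)

lemma L_Hom [simp]: "Hom L = Hom M"
  by (simp add: Hom_def fun_eq_iff)

lemma L_category: "category L"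
  using category_axioms by (simp add: category_def)

lemma L_is_functor [simp]: "is_functor J L D \<longleftrightarrow> is_functor J M D"
  using category_axioms L_category by (simp add: is_functor_def)

lemma L_is_functor' [simp]: "is_functor L D F \<longleftrightarrow> is_functor M D F"
  using category_axioms L_category by (simp add: is_functor_def)

lemma L_lifts_against [simp]: "lifts_against L = lifts_against M"
  by (simp add: lifts_against_def fun_eq_iff)

lemma L_factors_through [simp]: "factors_through L = factors_through M"
  by (simp add: factors_through_def fun_eq_iff)

lemma L_terminal [simp]: "terminal L = terminal M"
  by (simp add: terminal_def fun_eq_iff)

lemma L_retract_of [simp]: "retract_of L = retract_of M"
  by (simp add: retract_of_def fun_eq_iff)

lemma L_limit_cone: "limit_cone J L D X \<pi> \<longleftrightarrow> limit_cone J M D X \<pi>"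
  unfolding limit_cone_def cone_def by (simp only: L_simps L_Hom)

lemma L_colimit_cocone: "colimit_cocone J L D X \<iota> \<longleftrightarrow> colimit_cocone J M D X \<iota>"
  unfolding colimit_cocone_def cocone_def by (simp only: L_simps L_Hom)

lemma L_pullback_square: "pullback_square L p g p' g' \<longleftrightarrow> pullback_square M p g p' g'"
  unfolding pullback_square_def by (simp only: L_simps L_Hom)

lemma L_pushout_square: "pushout_square L i g i' g' \<longleftrightarrow> pushout_square M i g i' g'"
  unfolding pushout_square_def by (simp only: L_simps L_Hom)

lemma L_structured: "structured_homotopical_category \<kappa> L"
proof -
  have limits: "has_all_limits \<kappa> M" "has_all_colimits \<kappa> M"
    using sh by (simp_all add: structured_homotopical_category_def)
  have cof: "closed_under_retracts M (Cof M)" "closed_under_pushouts M (Cof M)"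
    using sh by (simp_all add: structured_homotopical_category_def)
  have "has_all_limits \<kappa> L"
    using limits(1) unfolding has_all_limits_def L_is_functor L_limit_cone .
  moreover have "has_all_colimits \<kappa> L"
    using limits(2) unfolding has_all_colimits_def L_is_functor L_colimit_cocone .
  moreover have "closed_under_retracts L (Cof M)"
    using cof(1) unfolding closed_under_retracts_def L_retract_of .
  moreover have "closed_under_pushouts L (Cof M)"
    using cof(2) unfolding closed_under_pushouts_def L_pushout_square .
  moreover have "closed_under_retracts L WR"
    unfolding closed_under_retracts_def L_retract_of using WR_retract by blast
  moreover have "two_out_of_three L WR"
    using WR_two_out_of_three unfolding two_out_of_three_def L_simps .
  moreover have "closed_under_retracts L (rlp M CofR)"
    unfolding closed_under_retracts_def L_retract_of using rlp_retract[OF CofR_Arr] by blast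
  moreover have "closed_under_pullbacks L (rlp M CofR)"
    unfolding closed_under_pullbacks_def L_pullback_square using rlp_pullback[OF CofR_Arr] by blast
  moreover have "rlp M CofR \<subseteq> Arr M"
    by (auto simp: rlp_def)
  ultimately show ?thesis
    using L_category Cof_Arr WR_Arr by (simp add: structured_homotopical_category_def)
qed

lemma L_fibrant: "fibrant L X \<longleftrightarrow> injective_object M CofR X"
proof
  assume "fibrant L X"
  then obtain T t where "terminal M T" "t \<in> Hom M X T" "t \<in> rlp M CofR"
    unfolding fibrant_def by auto
  then show "injective_object M CofR X"
    using rlp_terminal[OF CofR_Arr] by blast
next
  assume X: "injective_object M CofR X"
  obtain T where T: "terminal M T"
    using terminal_exists by blast
  obtain t where "t \<in> Hom M X T"
    using T X unfolding terminal_def injective_object_def by blast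
  then show "fibrant L X"
    using rlp_terminal[OF CofR_Arr T] X T unfolding fibrant_def by auto
qed

lemma L_fresse: "fresse_right_semimodel_category \<kappa> L"
  unfolding fresse_right_semimodel_category_def
proof (intro conjI ballI allI impI L_structured)
  fix i p assume "i \<in> Cof L \<inter> Weq L" "p \<in> core_fibrations L"
  then show "lifts_against L i p"
    by (simp add: core_fibrations_def rlp_def)
next
  fix i p assume i: "i \<in> Cof L" and p: "p \<in> core_fibrations L \<inter> Weq L"
  \<comment> \<open>Objects fibrant in \<open>L\<close> are fibrant in \<open>M\<close>, so
    \<open>p\<close> can be factored in \<open>M\<close> and the retract argument applies with
    \<open>W\<close> the R-equivalences.\<close>
  have "p \<in> rlp M CofR" "p \<in> WR" "fibrant M (Cod M p)"
    using p injective_CofR_fibrant by (simp_all add: core_fibrations_def L_fibrant)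
  then have "p \<in> rlp M (Cof M)"
    using acyclic_retract_argument[OF Weq_WR WR_two_out_of_three, of p "Dom M p" "Cod M p"]
    by (simp add: Hom_def rlp_def)
  then show "lifts_against L i p"
    using i by (simp add: rlp_def)
next
  fix f assume "f \<in> Arr L" and Y: "fibrant L (Cod L f)"
  then have f: "f \<in> Hom M (Dom M f) (Cod M f)" and Y: "injective_object M CofR (Cod M f)"
    by (auto simp: Hom_def L_fibrant)
  obtain E c g where cg: "c \<in> Hom M (Dom M f) E" "c \<in> CofR" "g \<in> Hom M E (Cod M f)" "g \<in> rlp M CofR"
      "g \<cdot> c = f"
    using factor_localized[OF f Y] by metis
  have "g \<in> core_fibrations L"
    using cg Y Hom_Cod[OF cg(3)] by (simp add: core_fibrations_def L_fibrant)
  then show "factors_through L (Cof L \<inter> Weq L) (core_fibrations L) f"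
    unfolding factors_through_def L_simps
    using cg(2,5) Hom_Cod[OF cg(1)] Hom_Dom[OF cg(3)] by metis
  \<comment> \<open>The factorization in \<open>M\<close> serves again: its second factor lifts
    against all cofibrations, equivalences are R-equivalences, and the target is fibrant in
    \<open>L\<close> by assumption.\<close>
  obtain E i q where iq: "i \<in> Hom M (Dom M f) E" "i \<in> Cof M" "q \<in> Hom M E (Cod M f)" "q \<in> Weq M"
    "q \<in> rlp M (Cof M)" "q \<cdot> i = f"
    using factor_acyclic[OF f injective_CofR_fibrant[OF Y]] by metis
  have "q \<in> core_fibrations L \<inter> WR"
    using iq Y Hom_Cod[OF iq(3)] rlp_Cof_CofR Weq_WR by (auto simp: core_fibrations_def L_fibrant)
  then show "factors_through L (Cof L) (core_fibrations L \<inter> Weq L) f"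
    unfolding factors_through_def L_simps
    using iq(2,6) Hom_Cod[OF iq(1)] Hom_Dom[OF iq(3)] by metis
next
  fix T assume T: "terminal L T"
  then have "Ident M T \<in> Hom M T T" "T \<in> Obj M"
    using Ident_closed by (auto simp: terminal_def)
  with T show "fibrant L T"
    unfolding L_fibrant using rlp_terminal[OF CofR_Arr] rlp_Ident[OF CofR_Arr] by auto
qed

text \<open>The weak factorization system stays the same, because \<open>L\<close> and
  \<open>M\<close> have the same acyclic fibrations. The retract argument now covers arbitrary
  targets, since the system factors every map.\<close>

lemma L_cospitzweck:
  assumes "cospitzweck_right_semimodel_category \<kappa> M"
  shows "cospitzweck_right_semimodel_category \<kappa> L"
proof -
  have wfs: "weak_factorization_system M (Cof M) (Fib M \<inter> Weq M)"
    using assms by (simp add: cospitzweck_right_semimodel_category_def)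
  then have AF: "Fib M \<inter> Weq M = rlp M (Cof M)"
    unfolding weak_factorization_system_def rlp_def by (rule conjunct1[OF conjunct2])
  have eq: "rlp M CofR \<inter> WR = Fib M \<inter> Weq M"
  proof
    show "Fib M \<inter> Weq M \<subseteq> rlp M CofR \<inter> WR"
      using AF rlp_Cof_CofR Weq_WR by blast
    show "rlp M CofR \<inter> WR \<subseteq> Fib M \<inter> Weq M"
    proof
      fix p assume p: "p \<in> rlp M CofR \<inter> WR"
      then have "p \<in> Arr M"
        by (simp add: rlp_def)
      then obtain i q where iq: "i \<in> Cof M" "q \<in> Fib M \<inter> Weq M" "Cod M i = Dom M q" "p = q \<cdot> i"
        using wfs unfolding weak_factorization_system_def factors_through_def by blast
      have i: "i \<in> Hom M (Dom M i) (Dom M q)" and q: "q \<in> Hom M (Dom M q) (Cod M q)"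
        using iq Cof_Arr Fib_Arr by (auto simp: Hom_def)
      have "i \<in> CofR"
        using WR_right[OF i q] p iq Weq_WR by blast
      then have "retract_of M p q"
        using retract_argument[OF i q] p iq(4) by blast
      then show "p \<in> Fib M \<inter> Weq M"
        using iq(2) Fib_retract Weq_retract by blast
    qed
  qed
  have "weak_factorization_system L (Cof L) (Fib L \<inter> Weq L)"
    using wfs unfolding weak_factorization_system_def L_simps eq L_lifts_against L_factors_through .
  then show ?thesis
    using L_fresse by (simp add: cospitzweck_right_semimodel_category_def)
qed

section \<open>Universal property of the localization\<close>

lemma left_adjoint_id: "left_adjoint_functor M L id_functor"
proof -
  have idf: "is_functor M M id_functor"
    using category_axioms by (auto simp: is_functor_def id_functor_def Hom_def)
  moreover have "id_functor \<circ>\<^sub>F id_functor = (id_functor :: ('o, 'a, 'o, 'a) cat_functor)"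
    by (simp add: comp_functor_def id_functor_def fun_eq_iff)
  moreover have "natural_transformation M M id_functor id_functor (Ident M)"
    using idf Ident_closed Ident_left_simp Ident_right_simp
    by (simp add: natural_transformation_def id_functor_def)
  ultimately have "adjunction M L id_functor id_functor (Ident M) (Ident M)"
    using Ident_left[OF Ident_closed]
    by (simp add: adjunction_def natural_transformation_def id_functor_def)
  then show ?thesis
    unfolding left_adjoint_functor_def by blast
qed

lemma left_quillen_id: "left_quillen_functor M L id_functor"
  using left_adjoint_id Weq_WR by (auto simp: left_quillen_functor_def id_functor_def)

text \<open>The same right adjoint, unit and counit work, as the underlying category is unchanged.
  Acyclic cofibrations of \<open>L\<close> are cofibrations in \<open>WR\<close>, which
  \<open>F\<close> sends to acyclic cofibrations by the two hypotheses.\<close>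

lemma left_quillen_L:
  assumes F: "left_quillen_functor M N F" and W: "AMap F ` WR \<subseteq> Weq N"
  shows "left_quillen_functor L N F"
proof -
  obtain G u c where "adjunction M N F G u c"
    using F by (auto simp: left_quillen_functor_def left_adjoint_functor_def)
  then have "adjunction L N F G u c"
    by (simp add: adjunction_def natural_transformation_def)
  then show ?thesis
    using F W by (auto simp: left_quillen_functor_def left_adjoint_functor_def)
qed

end

theorem theoremA:
  fixes \<kappa> :: "'u rel"
    and k :: semimodel_type
    and M :: "('o, 'a) hcategory"
    and R :: "('o, 'a, 'o, 'a) cat_functor"
    and \<eta> :: "'o \<Rightarrow> 'a"
  assumes "Cinfinite \<kappa>"
    and "right_semimodel_category k \<kappa> M"
    and "bf_reflector M R \<eta>"
  shows "right_semimodel_category k \<kappa> (reflector_localization M R)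
    \<and> left_bousfield_localization TYPE(('p, 'b) hcategory) k \<kappa> M (reflector_equivalences M R)
        (reflector_localization M R) id_functor"
proof -
  have "fresse_right_semimodel_category \<kappa> M"
    using assms(2) by (cases k) (auto simp: cospitzweck_right_semimodel_category_def)
  then interpret reflected_fresse \<kappa> M R \<eta>
    using assms by unfold_locales
  have L: "right_semimodel_category k \<kappa> L"
    using assms(2) L_fresse L_cospitzweck by (cases k) auto
  \<comment> \<open>The localization functor is the identity, so \<open>F\<close> is its own
    extension, and agreement with \<open>F\<close> on objects and arrows forces uniqueness.\<close>
  have "\<exists>G. left_quillen_functor L N G \<and> functor_eq M (G \<circ>\<^sub>F id_functor) F
      \<and> (\<forall>G'. left_quillen_functor L N G' \<and> functor_eq M (G' \<circ>\<^sub>F id_functor) F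
            \<longrightarrow> functor_eq L G' G)"
    if "left_quillen_functor M N F" "AMap F ` WR \<subseteq> Weq N"
    for N :: "('p, 'b) hcategory" and F
    using left_quillen_L[OF that]
    by (intro exI[of _ F]) (simp add: functor_eq_def comp_functor_def id_functor_def)
  then show ?thesis
    using L left_quillen_id by (simp add: left_bousfield_localization_def id_functor_def)
qed

end
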